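(* Let $G$ be a $K_4$-minor-free graph and $x,y,z$ distinct vertices of $G$. If $\{x,y,z\}$ is feasible, then $G$ is $(2,2,2)$-AT extendable with respect to $(x,y,z)$.
   Context: All graphs are finite and simple. For an orientation $D$ of a graph $G$, an Eulerian sub-digraph of $D$ is a spanning sub-digraph $F$ of $D$ with $d^+_F(v)=d^-_F(v)$ for every vertex $v$. Let $\mathrm{diff}(D)$ be the number of Eulerian sub-digraphs of $D$ with an even number of arcs minus the number with an odd number of arcs; $D$ is an AT-orientation if $\mathrm{diff}(D)\neq 0$. For $f:V(G)\to\mathbb{N}$, $G$ is $f$-AT if $G$ has an AT-orientation $D$ with $d^+_D(v)\le f(v)-1$ for every vertex $v$. Given distinct vertices $v_1,\dots,v_k$ and integers $a_i\in\{1,2\}$, define $f(v_i)=a_i$ for $i\in[k]$ and $f(v)=3$ for all other vertices; $G$ is $(a_1,\dots,a_k)$-AT extendable with respect to $(v_1,\dots,v_k)$ if $G$ is $f$-AT. For $n\in\mathbb{N}$, the chain of diamonds $D_n$ is the graph with vertex set $\{u_i,v_i,w_i:i\in[n]\}\cup\{u_0\}$ and edge set $\{u_{i-1}v_i,u_{i-1}w_i,v_iw_i,v_iu_i,w_iu_i: i\in[n]\}$; let $U(D_n)=\{u_0,\dots,u_n\}$. A set $X$ of distinct vertices of $G$ is connected by a chain of diamonds if there exist $n\in\mathbb{N}$ and a graph homomorphism $\varphi:D_n\to G$ with $X\subseteq\varphi(U(D_n))$. A set $X$ of three distinct vertices of $G$ is feasible if $X$ is not connected by a chain of diamonds and there is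 a proper $3$-coloring $\phi$ of $G$ with $|\phi(X)|\le 2$. *)

theory Defs
  imports Main
begin

definition simple_graph :: "'a set \<Rightarrow> ('a \<Rightarrow> 'a \<Rightarrow> bool) \<Rightarrow> bool" where
  "simple_graph V E \<longleftrightarrow> finite V \<and> (\<forall>u v. E u v \<longrightarrow> u \<in> V \<and> v \<in> V)
     \<and> (\<forall>u v. E u v \<longrightarrow> E v u) \<and> (\<forall>v. \<not> E v v)"

definition connected_in :: "('a \<Rightarrow> 'a \<Rightarrow> bool) \<Rightarrow> 'a set \<Rightarrow> bool" where
  "connected_in E B \<longleftrightarrow> (\<forall>u\<in>B. \<forall>v\<in>B. (\<lambda>a b. E a b \<and> a \<in> B \<and> b \<in> B)\<^sup>*\<^sup>* u v)"

definition has_K4_minor :: "'a set \<Rightarrow> ('a \<Rightarrow> 'a \<Rightarrow> bool) \<Rightarrow> bool" where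
  "has_K4_minor V E \<longleftrightarrow> (\<exists>B :: nat \<Rightarrow> 'a set.
     (\<forall>i<4. B i \<noteq> {} \<and> B i \<subseteq> V \<and> connected_in E (B i)) \<and>
     (\<forall>i<4. \<forall>j<4. i \<noteq> j \<longrightarrow> B i \<inter> B j = {} \<and> (\<exists>a\<in>B i. \<exists>b\<in>B j. E a b)))"

definition K4_minor_free :: "'a set \<Rightarrow> ('a \<Rightarrow> 'a \<Rightarrow> bool) \<Rightarrow> bool" where
  "K4_minor_free V E \<longleftrightarrow> \<not> has_K4_minor V E"

definition orientation :: "'a set \<Rightarrow> ('a \<Rightarrow> 'a \<Rightarrow> bool) \<Rightarrow> ('a \<times> 'a) set \<Rightarrow> bool" where
  "orientation V E A \<longleftrightarrow> A \<subseteq> {(u, v). E u v} \<and> (\<forall>u v. E u v \<longrightarrow> ((u, v) \<in> A \<longleftrightarrow> (v, u) \<notin> A))"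

definition outdeg :: "('a \<times> 'a) set \<Rightarrow> 'a \<Rightarrow> nat" where
  "outdeg A v = card {w. (v, w) \<in> A}"

definition indeg :: "('a \<times> 'a) set \<Rightarrow> 'a \<Rightarrow> nat" where
  "indeg A v = card {w. (w, v) \<in> A}"

(* Eulerian (spanning) sub-digraphs of D, identified with their arc sets *)
definition eulerian_sub :: "'a set \<Rightarrow> ('a \<times> 'a) set \<Rightarrow> ('a \<times> 'a) set \<Rightarrow> bool" where
  "eulerian_sub V A F \<longleftrightarrow> F \<subseteq> A \<and> (\<forall>v\<in>V. outdeg F v = indeg F v)"

definition diff :: "'a set \<Rightarrow> ('a \<times> 'a) set \<Rightarrow> int" where
  "diff V A = int (card {F. eulerian_sub V A F \<and> even (card F)})
            - int (card {F. eulerian_sub V A F \<and> odd (card F)})"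

definition AT_orientation :: "'a set \<Rightarrow> ('a \<times> 'a) set \<Rightarrow> bool" where
  "AT_orientation V A \<longleftrightarrow> diff V A \<noteq> 0"

definition f_AT :: "'a set \<Rightarrow> ('a \<Rightarrow> 'a \<Rightarrow> bool) \<Rightarrow> ('a \<Rightarrow> nat) \<Rightarrow> bool" where
  "f_AT V E f \<longleftrightarrow> (\<exists>A. orientation V E A \<and> AT_orientation V A \<and>
       (\<forall>v\<in>V. int (outdeg A v) \<le> int (f v) - 1))"

definition AT_extendable :: "'a set \<Rightarrow> ('a \<Rightarrow> 'a \<Rightarrow> bool) \<Rightarrow> nat list \<Rightarrow> 'a list \<Rightarrow> bool" where
  "AT_extendable V E as vs \<longleftrightarrow>
     f_AT V E (\<lambda>v. case map_of (zip vs as) v of Some a \<Rightarrow> a | None \<Rightarrow> 3)"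

datatype dvert = DU nat | DV nat | DW nat

definition diamond_verts :: "nat \<Rightarrow> dvert set" where
  "diamond_verts n = DU ` {0..n} \<union> DV ` {1..n} \<union> DW ` {1..n}"

definition diamond_edges0 :: "nat \<Rightarrow> (dvert \<times> dvert) set" where
  "diamond_edges0 n = (\<Union>i\<in>{1..n}. {(DU (i - 1), DV i), (DU (i - 1), DW i), (DV i, DW i),
                                      (DV i, DU i), (DW i, DU i)})"

definition diamond_adj :: "nat \<Rightarrow> dvert \<Rightarrow> dvert \<Rightarrow> bool" where
  "diamond_adj n a b \<longleftrightarrow> (a, b) \<in> diamond_edges0 n \<or> (b, a) \<in> diamond_edges0 n"

definition graph_hom :: "'b set \<Rightarrow> ('b \<Rightarrow> 'b \<Rightarrow> bool) \<Rightarrow> 'a set \<Rightarrow> ('a \<Rightarrow> 'a \<Rightarrow> bool)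
    \<Rightarrow> ('b \<Rightarrow> 'a) \<Rightarrow> bool" where
  "graph_hom V1 E1 V2 E2 \<phi> \<longleftrightarrow> (\<forall>a\<in>V1. \<phi> a \<in> V2) \<and> (\<forall>a b. E1 a b \<longrightarrow> E2 (\<phi> a) (\<phi> b))"

definition connected_by_chain_of_diamonds :: "'a set \<Rightarrow> ('a \<Rightarrow> 'a \<Rightarrow> bool) \<Rightarrow> 'a set \<Rightarrow> bool" where
  "connected_by_chain_of_diamonds V E X \<longleftrightarrow>
     (\<exists>n \<phi>. graph_hom (diamond_verts n) (diamond_adj n) V E \<phi> \<and> X \<subseteq> \<phi> ` (DU ` {0..n}))"

definition proper_3_coloring :: "'a set \<Rightarrow> ('a \<Rightarrow> 'a \<Rightarrow> bool) \<Rightarrow> ('a \<Rightarrow> nat) \<Rightarrow> bool" where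
  "proper_3_coloring V E c \<longleftrightarrow> (\<forall>v\<in>V. c v \<in> {1, 2, 3}) \<and> (\<forall>u v. E u v \<longrightarrow> c u \<noteq> c v)"

definition feasible :: "'a set \<Rightarrow> ('a \<Rightarrow> 'a \<Rightarrow> bool) \<Rightarrow> 'a set \<Rightarrow> bool" where
  "feasible V E X \<longleftrightarrow> X \<subseteq> V \<and> card X = 3 \<and> \<not> connected_by_chain_of_diamonds V E X \<and>
     (\<exists>c. proper_3_coloring V E c \<and> card (c ` X) \<le> 2)"

end

(*
  Over the field with two elements, the coefficient of a monomial m in the graph polynomial
  prod (x_u + x_v) is the parity of the number of orientations with out-degree sequence m.
  Relative to one such orientation D, the others arise by reversing an Eulerian sub-digraph, so an odd
  coefficient means an odd number of Eulerian sub-digraphs, whence diff D is odd. It remains to see that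
  x_x x_y x_z times the graph polynomial does not lie in the ideal generated by the cubes of the variables.

  This holds for triples of not necessarily distinct vertices. In a minimal counterexample all vertices of
  degree at most 2 are among x, y, z (otherwise delete one). If x has neighbours a, b, comparing coefficients
  of x_x^2 brings in the factor x_a + x_b: if a, b are not adjacent this factor is a new edge ab, and if they
  span a triangle with some c, then x_a + x_b may be replaced by x_c. This leaves only triangles attached to
  edges that lie in no other triangle. After removing them there are again two non-adjacent vertices of degree
  at most 2, one of which carries a single triangle; it is eliminated by comparing coefficients once more.
*)
theory Submission
  imports Defs "HOL-Library.Poly_Mapping" "HOL-Library.Z2" "HOL-Library.FuncSet"
begin

section \<open>Polynomials over the field with two elements\<close>

text \<open>The factor x_x x_y x_z makes the bound uniform: out-degree at most 1 at x, y, z and at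
  most 2 elsewhere becomes exponent at most 2 everywhere, so one ideal serves all triples in all
  graphs.

  If a, b, c span a triangle, then x_a + x_b + x_c times the graph polynomial lies in the ideal.
  Hence the variables at the two ends of a diamond act alike on it. If a chain of diamonds joins x,
  y and z, the product is congruent to x_x^3 times the graph polynomial and vanishes; feasibility
  has to exclude this.

  The same congruence carries a triple from one end of a diamond to the other, where it may meet
  another vertex of the triple. This is why repeated vertices are allowed; for x, x, z the
  condition, apart from 3-colourability, is that no chain joins x and z.

  A new edge ab may create diamonds or force colours, so feasibility need not survive it. What helps
  is that a coefficient often leaves only two of the three variables, and in a smaller graph a pair
  is subject to no condition at all.\<close>

type_synonym 'a poly2 = "('a \<Rightarrow>\<^sub>0 nat) \<Rightarrow>\<^sub>0 bit"

definition Var :: "'a \<Rightarrow> 'a poly2" where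
  "Var v = Poly_Mapping.single (Poly_Mapping.single v 1) 1"

text \<open>The ideal generated by the cubes of all variables. A monomial ideal contains a
  polynomial exactly when it contains every monomial of its support, so membership is a condition on
  \<open>keys\<close>.\<close>

definition cubes :: "'a poly2 set" where
  "cubes = {p. \<forall>m\<in>Poly_Mapping.keys p. \<exists>v. 3 \<le> Poly_Mapping.lookup m v}"

definition var_free :: "'a \<Rightarrow> 'a poly2 \<Rightarrow> bool" where
  "var_free v p \<longleftrightarrow> (\<forall>m\<in>Poly_Mapping.keys p. Poly_Mapping.lookup m v = 0)"

lemma two_eq_0: "(2::'a poly2) = 0"
proof -
  have "(2::'a poly2) = Poly_Mapping.single 0 2" by (rule single_numeral[symmetric])
  then show ?thesis by (simp only: bit_2_eq_0 single_zero)
qed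

lemma poly2_add_self [simp]: "(p::'a poly2) + p = 0"
  by (simp only: mult_2[symmetric] two_eq_0 mult_zero_left)

lemma poly2_add_self_left [simp]: "(p::'a poly2) + (p + q) = q"
  by (simp flip: add.assoc)

lemma cubes_add: "p \<in> cubes \<Longrightarrow> q \<in> cubes \<Longrightarrow> p + q \<in> cubes"
  unfolding cubes_def using keys_add[of p q] by blast

lemma cubes_mult: "p \<in> cubes \<Longrightarrow> q * p \<in> cubes"
proof -
  assume "p \<in> cubes"
  then have "\<exists>v. 3 \<le> Poly_Mapping.lookup (a + b) v" if "b \<in> Poly_Mapping.keys p" for a b
    using that unfolding cubes_def by (auto simp: lookup_add intro: trans_le_add2)
  then show "q * p \<in> cubes"
    unfolding cubes_def using keys_mult[of q p] by blast
qed

lemma Var_power: "Var v ^ k = Poly_Mapping.single (Poly_Mapping.single v k) 1"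
proof (induction k)
  case (Suc k)
  have "Poly_Mapping.single v 1 + Poly_Mapping.single v k = Poly_Mapping.single v (Suc k)"
    by (simp only: single_add[symmetric] plus_1_eq_Suc)
  with Suc show ?case by (simp only: Var_def power_Suc mult_single mult_1)
qed simp

lemma Var_cube: "Var v ^ 3 \<in> cubes"
  by (auto simp: Var_power cubes_def lookup_single intro!: exI[of _ v])

lemma var_free_add: "var_free v p \<Longrightarrow> var_free v q \<Longrightarrow> var_free v (p + q)"
  unfolding var_free_def using keys_add[of p q] by blast

lemma var_free_mult: "var_free v p \<Longrightarrow> var_free v q \<Longrightarrow> var_free v (p * q)"
proof -
  assume pq: "var_free v p" "var_free v q"
  show "var_free v (p * q)"
    unfolding var_free_def
  proof
    fix m assume "m \<in> Poly_Mapping.keys (p * q)"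
    then obtain a b where "m = a + b" "a \<in> Poly_Mapping.keys p" "b \<in> Poly_Mapping.keys q"
      using keys_mult[of p q] by blast
    with pq show "Poly_Mapping.lookup m v = 0" by (simp add: var_free_def lookup_add)
  qed
qed

lemma var_free_1: "var_free v 1"
  by (simp add: var_free_def)

lemma var_free_0: "var_free v 0"
  by (simp add: var_free_def)

lemma var_free_Var: "u \<noteq> v \<Longrightarrow> var_free v (Var u)"
  by (simp add: var_free_def Var_def lookup_single)

lemma var_free_power: "var_free v p \<Longrightarrow> var_free v (p ^ k)"
  by (induction k) (auto intro: var_free_mult var_free_1)

lemma var_free_prod: "(\<And>i. i \<in> S \<Longrightarrow> var_free v (f i)) \<Longrightarrow> var_free v (prod f S)"
  by (induction S rule: infinite_finite_induct) (auto intro: var_free_mult var_free_1)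

lemmas var_free_intros = var_free_add var_free_mult var_free_1 var_free_0 var_free_Var var_free_power

lemma poly2_as_sum:
  "(p::'a poly2) = (\<Sum>k\<in>Poly_Mapping.keys p. Poly_Mapping.single k 1)"
proof (rule poly_mapping_eqI)
  fix s
  have "Poly_Mapping.lookup (\<Sum>k\<in>Poly_Mapping.keys p. Poly_Mapping.single k 1) s
    = (\<Sum>k\<in>Poly_Mapping.keys p. if s = k then 1 else (0::bit))"
    unfolding lookup_sum lookup_single by (intro sum.cong refl) (auto simp: when_def)
  also have "\<dots> = (if s \<in> Poly_Mapping.keys p then 1 else 0)"
    by (simp only: sum.delta' finite_keys if_True)
  also have "\<dots> = Poly_Mapping.lookup p s"
    by (cases "Poly_Mapping.lookup p s") (simp_all add: in_keys_iff)
  finally show "Poly_Mapping.lookup p s = Poly_Mapping.lookup (\<Sum>k\<in>Poly_Mapping.keys p. Poly_Mapping.single k 1) s"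
    by (rule sym)
qed

lemma lookup_monomial_mult:
  "Poly_Mapping.lookup (Poly_Mapping.single t 1 * (p::'a poly2)) (t + s) = Poly_Mapping.lookup p s"
proof -
  have "Poly_Mapping.lookup (Poly_Mapping.single t 1 * p) (t + s)
    = (\<Sum>k\<in>Poly_Mapping.keys p. Poly_Mapping.lookup (Poly_Mapping.single (t + k) 1) (t + s))"
    by (subst poly2_as_sum) (simp only: sum_distrib_left mult_single lookup_sum mult_1)
  also have "\<dots> = Poly_Mapping.lookup (\<Sum>k\<in>Poly_Mapping.keys p. Poly_Mapping.single k 1) s"
    unfolding lookup_sum by (intro sum.cong refl) (simp add: lookup_single)
  also have "\<dots> = Poly_Mapping.lookup p s"
    by (simp only: poly2_as_sum[symmetric])
  finally show ?thesis .
qed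

lemma keys_monomial_mult:
  "m \<in> Poly_Mapping.keys (Poly_Mapping.single t 1 * (p::'a poly2)) \<Longrightarrow> \<exists>s\<in>Poly_Mapping.keys p. m = t + s"
  using keys_mult[of "Poly_Mapping.single t 1" p] by auto

text \<open>A monomial m of the coefficient of v^k, k < 3, does not contain v. If all its exponents
  are below 3, the same holds for v^k m, and no other summand can cancel it because all of them
  carry a different exponent of v. The cofactor \<open>r\<close> of the cube may itself contain
  v.\<close>

lemma cubes_extract:
  fixes p0 p1 p2 r :: "'a poly2"
  assumes q: "Var v ^ 3 * r + Var v ^ 2 * p2 + Var v * p1 + p0 \<in> cubes"
    and f: "var_free v p0" "var_free v p1" "var_free v p2"
  shows "p0 \<in> cubes" "p1 \<in> cubes" "p2 \<in> cubes"
proof -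
  define pp where "pp k = (if k = 0 then p0 else if k = 1 then p1 else if k = 2 then p2 else r)" for k :: nat
  have fr: "var_free v (pp k)" if "k < 3" for k using f that by (auto simp: pp_def)
  have q': "(\<Sum>k<4. Var v ^ k * pp k) \<in> cubes"
    using q by (simp add: pp_def eval_nat_numeral algebra_simps)
  have "pp k \<in> cubes" if k: "k < 3" for k
  proof (rule ccontr)
    assume "pp k \<notin> cubes"
    then obtain m where m: "m \<in> Poly_Mapping.keys (pp k)" "\<And>u. Poly_Mapping.lookup m u < 3"
      by (auto simp: cubes_def not_le)
    let ?m = "Poly_Mapping.single v k + m"
    have mv: "Poly_Mapping.lookup m v = 0" using fr[OF k] m(1) by (auto simp: var_free_def)
    have other: "Poly_Mapping.lookup (Var v ^ j * pp j) ?m = 0" if "j < 4" "j \<noteq> k" for j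
    proof (rule ccontr)
      assume "\<not> ?thesis"
      then have "?m \<in> Poly_Mapping.keys (Var v ^ j * pp j)" by (simp add: in_keys_iff)
      then obtain s where s: "s \<in> Poly_Mapping.keys (pp j)" "?m = Poly_Mapping.single v j + s"
        unfolding Var_power using keys_monomial_mult by blast
      have "k = j + Poly_Mapping.lookup s v"
        using arg_cong[OF s(2), of "\<lambda>m. Poly_Mapping.lookup m v"] mv by (simp add: lookup_add)
      \<comment> \<open>For j = 3 the cofactor may contain v, but then the exponent of v is at least
        3 and exceeds k.\<close>
      moreover have "j < 3 \<Longrightarrow> Poly_Mapping.lookup s v = 0" using fr s(1) by (auto simp: var_free_def)
      ultimately show False using that k by (cases "j = 3") auto
    qed
    have "Poly_Mapping.lookup (\<Sum>j<4. Var v ^ j * pp j) ?m = Poly_Mapping.lookup (Var v ^ k * pp k) ?m"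
      
    proof -
      have "(\<Sum>j\<in>{..<4} - {k}. Poly_Mapping.lookup (Var v ^ j * pp j) ?m) = 0"
        by (rule sum.neutral, rule ballI, rule other) simp_all
      then show ?thesis
        unfolding lookup_sum using k by (subst sum.remove[of _ k]) simp_all
    qed
    also have "\<dots> \<noteq> 0"
      using m(1) unfolding Var_power lookup_monomial_mult by (simp add: in_keys_iff)
    finally have "?m \<in> Poly_Mapping.keys (\<Sum>j<4. Var v ^ j * pp j)" by (simp add: in_keys_iff)
    moreover have "\<not> 3 \<le> Poly_Mapping.lookup ?m u" for u
      using m(2)[of u] mv k by (auto simp: lookup_add lookup_single when_def)
    ultimately show False using q' unfolding cubes_def mem_Collect_eq by blast
  qed
  from this[of 0] this[of 1] this[of 2] show "p0 \<in> cubes" "p1 \<in> cubes" "p2 \<in> cubes"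
    by (auto simp: pp_def)
qed

section \<open>Graph polynomials and orientations\<close>

definition edge_set :: "('a \<Rightarrow> 'a \<Rightarrow> bool) \<Rightarrow> 'a set set" where
  "edge_set E = {{u, v} |u v. E u v}"

text \<open>Signs vanish over the field with two elements, so x_u - x_v becomes a sum over the
  unordered pair and no reference orientation has to be chosen.\<close>

definition graph_poly :: "('a \<Rightarrow> 'a \<Rightarrow> bool) \<Rightarrow> 'a poly2" where
  "graph_poly E = (\<Prod>e\<in>edge_set E. \<Sum>v\<in>e. Var v)"

definition nb :: "('a \<Rightarrow> 'a \<Rightarrow> bool) \<Rightarrow> 'a \<Rightarrow> 'a set" where
  "nb E v = {w. E v w}"

definition del :: "('a \<Rightarrow> 'a \<Rightarrow> bool) \<Rightarrow> 'a set \<Rightarrow> 'a \<Rightarrow> 'a \<Rightarrow> bool" where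
  "del E S a b \<longleftrightarrow> E a b \<and> a \<notin> S \<and> b \<notin> S"

definition add_edge :: "('a \<Rightarrow> 'a \<Rightarrow> bool) \<Rightarrow> 'a \<Rightarrow> 'a \<Rightarrow> 'a \<Rightarrow> 'a \<Rightarrow> bool" where
  "add_edge E a b u w \<longleftrightarrow> E u w \<or> (u = a \<and> w = b) \<or> (u = b \<and> w = a)"

lemma finite_edge_set: "simple_graph V E \<Longrightarrow> finite (edge_set E)"
  by (rule finite_subset[of _ "Pow V"]) (auto simp: edge_set_def simple_graph_def)

lemma finite_nb: "simple_graph V E \<Longrightarrow> finite (nb E v)"
  by (rule finite_subset[of _ V]) (auto simp: nb_def simple_graph_def)

lemma simple_del: "simple_graph V E \<Longrightarrow> simple_graph (V - S) (del E S)"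
  by (auto simp: simple_graph_def del_def)

text \<open>The second factor is free of v. This is the form in which coefficients of powers of x_v
  are read off.\<close>

lemma graph_poly_del:
  assumes "simple_graph V E"
  shows "graph_poly E = (\<Prod>w\<in>nb E v. Var v + Var w) * graph_poly (del E {v})"
proof -
  have sym: "\<And>a b. E a b \<Longrightarrow> E b a" and irr: "\<And>a. \<not> E a a"
    using assms by (auto simp: simple_graph_def)
  have split: "edge_set E = (\<lambda>w. {v, w}) ` nb E v \<union> edge_set (del E {v})" (is "_ = ?N \<union> ?D")
  proof (intro equalityI subsetI)
    fix e assume "e \<in> edge_set E"
    then obtain a b where e: "e = {a, b}" "E a b" by (auto simp: edge_set_def)
    have "e \<in> ?N" if "a = v" by (rule image_eqI[of _ _ b]) (use e that in \<open>simp_all add: nb_def\<close>)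
    moreover have "e \<in> ?N" if "b = v"
      by (rule image_eqI[of _ _ a]) (use e that sym[of a b] in \<open>simp_all add: nb_def insert_commute\<close>)
    moreover have "e \<in> ?D" if "a \<noteq> v" "b \<noteq> v"
      unfolding edge_set_def del_def mem_Collect_eq
      by (intro exI[of _ a] exI[of _ b]) (use e that in simp)
    ultimately show "e \<in> ?N \<union> ?D" by blast
  next
    fix e assume "e \<in> ?N \<union> ?D"
    then show "e \<in> edge_set E" by (auto simp: edge_set_def nb_def del_def)
  qed
  have "finite (?N \<union> ?D)"
    unfolding split[symmetric] by (rule finite_edge_set[OF assms])
  then have "finite ?N" "finite ?D" by simp_all
  moreover have "?N \<inter> ?D = {}"
  proof -
    have "v \<notin> e" if "e \<in> ?D" for e using that by (auto simp: edge_set_def del_def)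
    then show ?thesis by blast
  qed
  ultimately have "graph_poly E = (\<Prod>e\<in>?N. \<Sum>v\<in>e. Var v) * graph_poly (del E {v})"
    unfolding graph_poly_def split by (rule prod.union_disjoint)
  also have "(\<Prod>e\<in>?N. \<Sum>v\<in>e. Var v) = (\<Prod>w\<in>nb E v. Var v + Var w)"
  proof (subst prod.reindex)
    show "inj_on (\<lambda>w. {v, w}) (nb E v)" by (auto simp: inj_on_def doubleton_eq_iff)
    show "prod ((\<lambda>e. \<Sum>v\<in>e. Var v) \<circ> (\<lambda>w. {v, w})) (nb E v) = (\<Prod>w\<in>nb E v. Var v + Var w)"
    proof (intro prod.cong refl)
      fix w assume "w \<in> nb E v"
      then have "v \<noteq> w" using irr[of v] by (auto simp: nb_def)
      then show "((\<lambda>e. \<Sum>v\<in>e. Var v) \<circ> (\<lambda>w. {v, w})) w = Var v + Var w" by simp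
    qed
  qed
  finally show ?thesis .
qed

lemma graph_poly_add_edge:
  assumes "simple_graph V E" "\<not> E a b" "a \<noteq> b"
  shows "graph_poly (add_edge E a b) = (Var a + Var b) * graph_poly E"
proof -
  have "edge_set (add_edge E a b) = insert {a, b} (edge_set E)"
    unfolding edge_set_def add_edge_def by blast
  moreover have "{a, b} \<notin> edge_set E"
  proof
    assume "{a, b} \<in> edge_set E"
    then have "E a b \<or> E b a" by (auto simp: edge_set_def doubleton_eq_iff)
    then show False using assms unfolding simple_graph_def by blast
  qed
  ultimately show ?thesis
    using assms finite_edge_set[OF assms(1)] by (simp add: graph_poly_def)
qed

lemma var_free_graph_poly:
  assumes "simple_graph V E" "nb E v = {}"
  shows "var_free v (graph_poly E)"
  unfolding graph_poly_def
proof (rule var_free_prod)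
  fix e assume "e \<in> edge_set E"
  then obtain a b where e: "e = {a, b}" "E a b" by (auto simp: edge_set_def)
  from assms(1) e(2) have "E b a" "a \<noteq> b" by (auto simp: simple_graph_def)
  with assms(2) e(2) have "a \<noteq> v" "b \<noteq> v" by (auto simp: nb_def)
  with \<open>a \<noteq> b\<close> e show "var_free v (\<Sum>v\<in>e. Var v)" by (simp add: var_free_add var_free_Var)
qed

lemma var_free_graph_poly_del:
  "simple_graph V E \<Longrightarrow> v \<in> S \<Longrightarrow> var_free v (graph_poly (del E S))"
  by (rule var_free_graph_poly[OF simple_del]) (auto simp: nb_def del_def)

lemma graph_poly_no_edges: "(\<And>a b. \<not> E a b) \<Longrightarrow> graph_poly E = 1"
  by (simp add: graph_poly_def edge_set_def)

section \<open>Orientations with prescribed out-degrees\<close>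

definition tail_monomial :: "('a \<Rightarrow> 'a \<Rightarrow> bool) \<Rightarrow> ('a set \<Rightarrow> 'a) \<Rightarrow> 'a \<Rightarrow>\<^sub>0 nat" where
  "tail_monomial E g = (\<Sum>e\<in>edge_set E. Poly_Mapping.single (g e) 1)"

definition arcs_of :: "('a \<Rightarrow> 'a \<Rightarrow> bool) \<Rightarrow> ('a set \<Rightarrow> 'a) \<Rightarrow> ('a \<times> 'a) set" where
  "arcs_of E g = {(u, v). E u v \<and> g {u, v} = u}"

lemma prod_Var:
  "finite S \<Longrightarrow> (\<Prod>e\<in>S. Var (g e)) = Poly_Mapping.single (\<Sum>e\<in>S. Poly_Mapping.single (g e) 1) 1"
  by (induction S rule: finite_induct) (simp_all add: Var_def mult_single)

text \<open>Multiplying out picks one endpoint from each edge. Such choice functions are thus the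
  terms of the product and, with the chosen endpoint read as the tail, the orientations of the
  graph.\<close>

lemma graph_poly_expand:
  assumes "simple_graph V E"
  shows "graph_poly E = (\<Sum>g\<in>Pi\<^sub>E (edge_set E) (\<lambda>e. e). Poly_Mapping.single (tail_monomial E g) 1)"
proof -
  have "finite e" if "e \<in> edge_set E" for e using that by (auto simp: edge_set_def)
  then have "graph_poly E = (\<Sum>g\<in>Pi\<^sub>E (edge_set E) (\<lambda>e. e). \<Prod>e\<in>edge_set E. Var (g e))"
    unfolding graph_poly_def using finite_edge_set[OF assms] by (rule prod_sum_PiE[rotated])
  then show ?thesis
    by (simp only: prod_Var[OF finite_edge_set[OF assms]] tail_monomial_def)
qed

lemma odd_card_tails:
  assumes "simple_graph V E" "m \<in> Poly_Mapping.keys (graph_poly E)"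
  shows "odd (card {g \<in> Pi\<^sub>E (edge_set E) (\<lambda>e. e). tail_monomial E g = m})"
proof -
  let ?P = "Pi\<^sub>E (edge_set E) (\<lambda>e. e)"
  have fin: "finite ?P"
    by (intro finite_PiE finite_edge_set[OF assms(1)]) (auto simp: edge_set_def)
  have "Poly_Mapping.lookup (graph_poly E) m = (\<Sum>g\<in>?P. if tail_monomial E g = m then 1 else 0)"
    unfolding graph_poly_expand[OF assms(1)] lookup_sum lookup_single
    by (intro sum.cong refl) (simp add: when_def)
  also have "\<dots> = of_nat (card {g \<in> ?P. tail_monomial E g = m})"
    by (simp only: sum.inter_filter[OF fin, symmetric] sum_constant mult_1_right)
  finally have "(of_nat (card {g \<in> ?P. tail_monomial E g = m}) :: bit) \<noteq> 0"
    using assms(2) unfolding in_keys_iff by (simp only: not_False_eq_True)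
  moreover have "(of_nat n :: bit) = 0" if "even n" for n
  proof -
    from that obtain k where "n = 2 * k" by (rule evenE)
    then show ?thesis by (simp only: of_nat_mult of_nat_numeral bit_2_eq_0 mult_zero_left)
  qed
  ultimately show ?thesis by blast
qed

lemma outdeg_arcs_of:
  assumes "simple_graph V E" "g \<in> Pi\<^sub>E (edge_set E) (\<lambda>e. e)"
  shows "outdeg (arcs_of E g) v = Poly_Mapping.lookup (tail_monomial E g) v"
proof -
  have "Poly_Mapping.lookup (tail_monomial E g) v = (\<Sum>e\<in>edge_set E. if g e = v then 1 else 0)"
    unfolding tail_monomial_def lookup_sum lookup_single by (intro sum.cong refl) (simp add: when_def)
  also have "\<dots> = card {e \<in> edge_set E. g e = v}"
    by (simp only: sum.inter_filter[OF finite_edge_set[OF assms(1)], symmetric] card_eq_sum)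
  also have "{e \<in> edge_set E. g e = v} = (\<lambda>w. {v, w}) ` {w. (v, w) \<in> arcs_of E g}" (is "?L = ?R")
  proof (intro equalityI subsetI)
    fix e assume "e \<in> ?L"
    then have e: "e \<in> edge_set E" "g e = v" by simp_all
    from e(1) obtain a b where ab: "e = {a, b}" "E a b" by (auto simp: edge_set_def)
    have "E b a" using assms(1) ab by (auto simp: simple_graph_def)
    have "v \<in> {a, b}" using PiE_mem[OF assms(2) e(1)] e(2) ab(1) by simp
    then consider "v = a" | "v = b" by blast
    then have "\<exists>w. e = {v, w} \<and> E v w"
    proof cases
      case 1 with ab show ?thesis by (intro exI[of _ b]) simp
    next
      case 2 with ab \<open>E b a\<close> show ?thesis by (intro exI[of _ a]) (simp add: insert_commute)
    qed
    then obtain w where "e = {v, w}" "E v w" by blast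
    with e(2) show "e \<in> ?R" by (intro image_eqI[of _ _ w]) (simp_all add: arcs_of_def)
  next
    fix e assume "e \<in> ?R"
    then obtain w where "e = {v, w}" "E v w" "g {v, w} = v" by (auto simp: arcs_of_def)
    then show "e \<in> ?L"
      unfolding edge_set_def mem_Collect_eq by (intro conjI exI[of _ v] exI[of _ w]) simp_all
  qed
  also have "card \<dots> = card {w. (v, w) \<in> arcs_of E g}"
    by (rule card_image) (auto simp: inj_on_def doubleton_eq_iff)
  finally show ?thesis by (simp add: outdeg_def)
qed

text \<open>Arcs at v common to A and B count equally on both sides; the other arcs of B leaving v
  are the reversals of the arcs of \<open>A - B\<close> entering v. Hence A and B have the same
  out-degree at v exactly when \<open>A - B\<close> is balanced there.\<close>

lemma outdeg_reorient:
  fixes A B :: "('a \<times> 'a) set"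
  assumes fin: "finite A" "finite B"
    and rev: "\<And>u v. (v, u) \<in> B - A \<longleftrightarrow> (u, v) \<in> A - B"
  shows "outdeg B v + outdeg (A - B) v = outdeg A v + indeg (A - B) v"
proof -
  have f: "finite {w. (v, w) \<in> X}" if "finite X" for X :: "('a \<times> 'a) set"
    using finite_Image[OF that, of "{v}"] by (simp add: Image_def)
  have split: "outdeg X v = card {w. (v, w) \<in> X \<inter> Y} + outdeg (X - Y) v" if "finite X" for X Y :: "('a \<times> 'a) set"
  proof -
    have "{w. (v, w) \<in> X} = {w. (v, w) \<in> X \<inter> Y} \<union> {w. (v, w) \<in> X - Y}" by auto
    moreover have "card ({w. (v, w) \<in> X \<inter> Y} \<union> {w. (v, w) \<in> X - Y})
      = card {w. (v, w) \<in> X \<inter> Y} + card {w. (v, w) \<in> X - Y}"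
      by (intro card_Un_disjoint f finite_Int finite_Diff disjI1 that) auto
    ultimately show ?thesis by (simp only: outdeg_def)
  qed
  have "outdeg (B - A) v = indeg (A - B) v"
    unfolding outdeg_def indeg_def by (simp only: rev)
  with split[OF fin(1), of B] split[OF fin(2), of A] show ?thesis
    by (simp only: Int_commute[of B A])
qed

lemma AT_orientation_of_monomial:
  assumes G: "simple_graph V E" and m: "m \<in> Poly_Mapping.keys (graph_poly E)"
  shows "\<exists>A. orientation V E A \<and> AT_orientation V A \<and> (\<forall>v. outdeg A v = Poly_Mapping.lookup m v)"
proof -
  let ?T = "{g \<in> Pi\<^sub>E (edge_set E) (\<lambda>e. e). tail_monomial E g = m}"
  have odd: "odd (card ?T)" by (rule odd_card_tails[OF assms])
  then have "?T \<noteq> {}" by (metis card.empty even_zero)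
  then obtain g0 where g0: "g0 \<in> ?T" by blast
  have sym: "\<And>a b. E a b \<Longrightarrow> E b a" and irr: "\<And>a. \<not> E a a"
    and inV: "\<And>a b. E a b \<Longrightarrow> a \<in> V \<and> b \<in> V" and finV: "finite V"
    using G by (auto simp: simple_graph_def)
  have tail: "g {a, b} = a \<or> g {a, b} = b" if "g \<in> Pi\<^sub>E (edge_set E) (\<lambda>e. e)" "E a b" for g a b
    using that PiE_mem[of g "edge_set E" "\<lambda>e. e" "{a, b}"] by (auto simp: edge_set_def)
  let ?A = "arcs_of E g0"
  have orient: "orientation V E ?A"
    unfolding orientation_def
  proof (intro conjI allI impI)
    show "?A \<subseteq> {(u, v). E u v}" by (auto simp: arcs_of_def)
    fix u v assume uv: "E u v"
    then have "u \<noteq> v" "E v u" using irr[of u] sym[of u v] by auto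
    moreover have "g0 {u, v} = u \<or> g0 {u, v} = v" using tail[OF _ uv] g0 by blast
    ultimately show "((u, v) \<in> ?A) = ((v, u) \<notin> ?A)"
      using uv by (auto simp: arcs_of_def insert_commute)
  qed
  have A_D: "E a b" "a \<noteq> b" "g0 {a, b} = a" "(b, a) \<notin> ?A" if "(a, b) \<in> ?A" for a b
    using that irr[of a] by (auto simp: arcs_of_def insert_commute)
  have finA: "finite (arcs_of E g)" for g
    by (rule finite_subset[of _ "V \<times> V"]) (use inV finV in \<open>auto simp: arcs_of_def\<close>)
  have rev: "(b, a) \<in> arcs_of E g - arcs_of E h \<longleftrightarrow> (a, b) \<in> arcs_of E h - arcs_of E g"
    if "g \<in> Pi\<^sub>E (edge_set E) (\<lambda>e. e)" "h \<in> Pi\<^sub>E (edge_set E) (\<lambda>e. e)" for a b g h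
    using tail[OF that(1), of a b] tail[OF that(2), of a b] irr[of a] sym[of a b] sym[of b a]
    by (auto simp: arcs_of_def insert_commute)
  have same: "outdeg (arcs_of E g) v = Poly_Mapping.lookup m v" if "g \<in> ?T" for g v
    using outdeg_arcs_of[OF G, of g v] that by simp
  \<comment> \<open>The set of reversed arcs determines \<open>g\<close>, since an edge has only two
    possible tails; it is balanced because all choices in \<open>?T\<close> have equal
    out-degrees.\<close>
  have bij: "bij_betw (\<lambda>g. ?A - arcs_of E g) ?T {F. eulerian_sub V ?A F}"
  proof (rule bij_betw_imageI)
    show "inj_on (\<lambda>g. ?A - arcs_of E g) ?T"
    proof (rule inj_onI)
      fix g h assume g: "g \<in> ?T" and h: "h \<in> ?T" and eq: "?A - arcs_of E g = ?A - arcs_of E h"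
      have "g e = h e" if "e \<in> edge_set E" for e
      proof -
        from that obtain a b where e: "e = {a, b}" "E a b" by (auto simp: edge_set_def)
        from orient e(2) have "(a, b) \<in> ?A \<or> (b, a) \<in> ?A" unfolding orientation_def by blast
        then obtain a b where ab: "e = {a, b}" "(a, b) \<in> ?A"
          using e(1) by (metis insert_commute)
        have "(a, b) \<in> arcs_of E g \<longleftrightarrow> (a, b) \<in> arcs_of E h" using eq ab(2) by blast
        moreover have "g {a, b} = a \<or> g {a, b} = b" "h {a, b} = a \<or> h {a, b} = b"
          using tail[OF _ A_D(1)[OF ab(2)]] g h by blast+
        ultimately show ?thesis
          using A_D(1)[OF ab(2)] unfolding ab(1) arcs_of_def by auto
      qed
      then show "g = h" using g h by (intro PiE_ext[of g "edge_set E" "\<lambda>e. e" h]) simp_all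
    qed
    show "(\<lambda>g. ?A - arcs_of E g) ` ?T = {F. eulerian_sub V ?A F}"
    proof (intro equalityI subsetI)
      fix F assume "F \<in> (\<lambda>g. ?A - arcs_of E g) ` ?T"
      then obtain g where g: "g \<in> ?T" and F: "F = ?A - arcs_of E g" by blast
      have "outdeg F v = indeg F v" for v
      proof -
        have "outdeg (arcs_of E g) v + outdeg F v = outdeg ?A v + indeg F v"
          unfolding F by (rule outdeg_reorient[OF finA finA rev]) (use g g0 in simp_all)
        then show ?thesis by (simp only: same[OF g] same[OF g0])
      qed
      then show "F \<in> {F. eulerian_sub V ?A F}" by (auto simp: eulerian_sub_def F)
    next
      fix F assume "F \<in> {F. eulerian_sub V ?A F}"
      then have FA: "F \<subseteq> ?A" and eul: "\<And>v. v \<in> V \<Longrightarrow> outdeg F v = indeg F v"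
        by (auto simp: eulerian_sub_def)
      \<comment> \<open>The inverse map: an edge carrying an arc of F takes the head of that arc as
        its new tail, every other edge keeps its tail under \<open>g0\<close>. The value
        \<open>undefined\<close> off the edge set makes \<open>g\<close> extensional, as
        \<open>Pi\<^sub>E\<close> requires.\<close>
      define head where "head e b \<longleftrightarrow> (\<exists>a. e = {a, b} \<and> (a, b) \<in> F)" for e b
      define g where "g e = (if e \<in> edge_set E
        then if \<exists>b. head e b then (THE b. head e b) else g0 e else undefined)" for e
      have gF: "g {a, b} = b" if ab: "(a, b) \<in> F" for a b
      proof -
        have A: "(a, b) \<in> ?A" using ab FA by blast
        have "(b, a) \<notin> F" using A_D(4)[OF A] FA by blast
        have "{a, b} \<in> edge_set E" using A_D(1)[OF A] by (auto simp: edge_set_def)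
        have h: "head {a, b} b" unfolding head_def using ab by blast
        have "(THE b'. head {a, b} b') = b"
        proof (rule the_equality[of "head {a, b}", OF h])
          fix b' assume "head {a, b} b'"
          then obtain a' where "{a, b} = {a', b'}" "(a', b') \<in> F" unfolding head_def by blast
          with \<open>(b, a) \<notin> F\<close> show "b' = b" unfolding doubleton_eq_iff by blast
        qed
        then show ?thesis unfolding g_def using h \<open>{a, b} \<in> edge_set E\<close> by (simp only: if_True) metis
      qed
      have gN: "g {a, b} = g0 {a, b}" if "E a b" "(a, b) \<notin> F" "(b, a) \<notin> F" for a b
      proof -
        have "\<not> (\<exists>c. head {a, b} c)" using that unfolding head_def doubleton_eq_iff by blast
        moreover have "{a, b} \<in> edge_set E" unfolding edge_set_def using that by blast
        ultimately show ?thesis unfolding g_def by (simp only: if_True if_False)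
      qed
      have gP: "g \<in> Pi\<^sub>E (edge_set E) (\<lambda>e. e)"
      proof (rule PiE_I)
        fix e assume "e \<in> edge_set E"
        then obtain a b where e: "e = {a, b}" "E a b" by (auto simp: edge_set_def)
        show "g e \<in> e"
        proof (cases "(a, b) \<in> F \<or> (b, a) \<in> F")
          case True
          then have "g {a, b} \<in> {a, b}" using gF[of a b] gF[of b a] by (auto simp: insert_commute)
          then show ?thesis by (simp only: e(1))
        next
          case False
          then have "g {a, b} = g0 {a, b}" by (intro gN e) blast+
          moreover have "g0 {a, b} = a \<or> g0 {a, b} = b" using tail[OF _ e(2)] g0 by blast
          ultimately have "g {a, b} \<in> {a, b}" by auto
          then show ?thesis by (simp only: e(1))
        qed
      qed (simp add: g_def)
      have F: "?A - arcs_of E g = F"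
      proof -
        have "(a, b) \<in> ?A - arcs_of E g \<longleftrightarrow> (a, b) \<in> F" for a b
        proof (cases "(a, b) \<in> ?A")
          case True
          note A = A_D[OF True]
          have "(b, a) \<notin> F" using A(4) FA by blast
          with A(1-3) show ?thesis using True gF[of a b] gN[of a b] by (auto simp: arcs_of_def)
        next
          case False then show ?thesis using FA by auto
        qed
        then show ?thesis by auto
      qed
      \<comment> \<open>\<open>eulerian_sub\<close> speaks only of vertices in V; elsewhere there
        are no arcs and both degrees are 0.\<close>
      have eulF: "outdeg F v = indeg F v" for v
      proof (cases "v \<in> V")
        case False
        then have "{w. (v, w) \<in> F} = {}" "{w. (w, v) \<in> F} = {}"
          using FA inV by (auto simp: arcs_of_def)
        then show ?thesis by (simp add: outdeg_def indeg_def)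
      qed (rule eul)
      have "outdeg (arcs_of E g) v = outdeg ?A v" for v
      proof -
        have "outdeg (arcs_of E g) v + outdeg F v = outdeg ?A v + indeg F v"
          unfolding F[symmetric] by (rule outdeg_reorient[OF finA finA rev[OF gP]]) (use g0 in simp)
        then show ?thesis by (simp only: eulF)
      qed
      then have "tail_monomial E g = m"
        using outdeg_arcs_of[OF G gP] same[OF g0] by (intro poly_mapping_eqI) simp
      with gP F show "F \<in> (\<lambda>g. ?A - arcs_of E g) ` ?T" by blast
    qed
  qed
  have fin: "finite {F. eulerian_sub V ?A F}"
    by (rule finite_subset[of _ "Pow ?A"]) (auto simp: eulerian_sub_def finA)
  have "{F. eulerian_sub V ?A F}
    = {F. eulerian_sub V ?A F \<and> even (card F)} \<union> {F. eulerian_sub V ?A F \<and> odd (card F)}" by auto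
  moreover have "card ({F. eulerian_sub V ?A F \<and> even (card F)} \<union> {F. eulerian_sub V ?A F \<and> odd (card F)})
    = card {F. eulerian_sub V ?A F \<and> even (card F)} + card {F. eulerian_sub V ?A F \<and> odd (card F)}"
    by (rule card_Un_disjoint) (auto intro: finite_subset[OF _ fin])
  moreover have "odd (card {F. eulerian_sub V ?A F})"
    using odd bij_betw_same_card[OF bij] by simp
  ultimately have "odd (card {F. eulerian_sub V ?A F \<and> even (card F)}
      + card {F. eulerian_sub V ?A F \<and> odd (card F)})"
    by (simp only: not_False_eq_True)
  moreover have "odd (p + q) \<Longrightarrow> int p - int q \<noteq> 0" for p q :: nat by auto
  ultimately have "AT_orientation V ?A"
    unfolding AT_orientation_def diff_def by blast
  then show ?thesis using orient same[OF g0] by blast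
qed

section \<open>Minors and vertices of small degree\<close>

text \<open>The edge between x and a is contracted and the merged vertex keeps the name a;
  \<open>u \<noteq> w\<close> discards the loop that arises.\<close>

definition contract :: "('a \<Rightarrow> 'a \<Rightarrow> bool) \<Rightarrow> 'a \<Rightarrow> 'a \<Rightarrow> 'a \<Rightarrow> 'a \<Rightarrow> bool" where
  "contract E x a u w \<longleftrightarrow> u \<noteq> w \<and> u \<noteq> x \<and> w \<noteq> x \<and> (E u w \<or> (u = a \<and> E x w) \<or> (w = a \<and> E x u))"

lemma simple_graphD:
  assumes "simple_graph V E"
  shows "finite V" "E u v \<Longrightarrow> u \<in> V" "E u v \<Longrightarrow> v \<in> V" "E u v \<Longrightarrow> E v u" "\<not> E v v"
  using assms unfolding simple_graph_def by blast+

lemma simple_contract: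
  assumes "simple_graph V E" "E x a"
  shows "simple_graph (V - {x}) (contract E x a)"
proof -
  note G = simple_graphD[OF assms(1)]
  show ?thesis
    unfolding simple_graph_def contract_def
    using G(1) G(2) G(3) G(4) G(5) assms(2) by blast
qed

lemma simple_add_edge:
  "simple_graph V E \<Longrightarrow> a \<in> V \<Longrightarrow> b \<in> V \<Longrightarrow> a \<noteq> b \<Longrightarrow> simple_graph V (add_edge E a b)"
  unfolding simple_graph_def add_edge_def by blast

lemma connected_in_mono:
  assumes "connected_in E' B" "\<And>a b. E' a b \<Longrightarrow> E a b"
  shows "connected_in E B"
  unfolding connected_in_def
proof (intro ballI)
  fix u v assume "u \<in> B" "v \<in> B"
  with assms(1) have "(\<lambda>a b. E' a b \<and> a \<in> B \<and> b \<in> B)\<^sup>*\<^sup>* u v" by (simp add: connected_in_def)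
  then show "(\<lambda>a b. E a b \<and> a \<in> B \<and> b \<in> B)\<^sup>*\<^sup>* u v"
    by (rule rtranclp_mono[THEN predicate2D, rotated]) (use assms(2) in blast)
qed

lemma K4_minor_subgraph:
  assumes "has_K4_minor V' E'" "V' \<subseteq> V" "\<And>a b. E' a b \<Longrightarrow> E a b"
  shows "has_K4_minor V E"
proof -
  from assms(1) obtain B :: "nat \<Rightarrow> 'a set" where B: "\<forall>i<4. B i \<noteq> {} \<and> B i \<subseteq> V' \<and> connected_in E' (B i)"
    "\<forall>i<4. \<forall>j<4. i \<noteq> j \<longrightarrow> B i \<inter> B j = {} \<and> (\<exists>a\<in>B i. \<exists>b\<in>B j. E' a b)"
    unfolding has_K4_minor_def by (elim exE conjE)
  show ?thesis
    unfolding has_K4_minor_def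
  proof (intro exI[of _ B] conjI allI impI)
    fix i :: nat assume "i < 4"
    with B(1) have i: "B i \<noteq> {}" "B i \<subseteq> V'" "connected_in E' (B i)" by simp_all
    show "B i \<noteq> {}" "B i \<subseteq> V" using i(1,2) assms(2) by simp_all
    show "connected_in E (B i)" by (rule connected_in_mono[OF i(3) assms(3)])
    fix j :: nat assume "j < 4" "i \<noteq> j"
    with B(2) \<open>i < 4\<close> have ij: "B i \<inter> B j = {}" "\<exists>a\<in>B i. \<exists>b\<in>B j. E' a b" by simp_all
    show "B i \<inter> B j = {}" by (rule ij(1))
    show "\<exists>a\<in>B i. \<exists>b\<in>B j. E a b" using ij(2) assms(3) by blast
  qed
qed

lemma K4_minor_contract:
  assumes G: "simple_graph V E" and xa: "E x a"
    and minor: "has_K4_minor (V - {x}) (contract E x a)"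
  shows "has_K4_minor V E"
proof -
  note S = simple_graphD[OF G]
  from minor obtain B :: "nat \<Rightarrow> 'a set" where
    B: "\<forall>i<4. B i \<noteq> {} \<and> B i \<subseteq> V - {x} \<and> connected_in (contract E x a) (B i)"
    "\<forall>i<4. \<forall>j<4. i \<noteq> j \<longrightarrow> B i \<inter> B j = {} \<and> (\<exists>p\<in>B i. \<exists>q\<in>B j. contract E x a p q)"
    unfolding has_K4_minor_def by (elim exE conjE)
  have B1: "B i \<noteq> {}" "B i \<subseteq> V - {x}" "connected_in (contract E x a) (B i)" if "i < 4" for i
    using B(1) that by simp_all
  have B2: "B i \<inter> B j = {}" "\<exists>p\<in>B i. \<exists>q\<in>B j. contract E x a p q" if "i < 4" "j < 4" "i \<noteq> j" for i j
    using B(2) that by simp_all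
  \<comment> \<open>The branch set containing the merged vertex, if there is one, takes x
    back.\<close>
  define C where "C i = (if a \<in> B i then insert x (B i) else B i)" for i
  have BC: "B i \<subseteq> C i" "a \<in> B i \<Longrightarrow> x \<in> C i" "C i \<subseteq> insert x (B i)" for i by (auto simp: C_def)
  have xC: "a \<in> B i" if "x \<in> C i" "i < 4" for i
    using B1(2)[OF that(2)] that(1) by (auto simp: C_def split: if_splits)
  have conn: "connected_in E (C i)" if i: "i < 4" for i
  proof -
    define R where "R p q \<longleftrightarrow> E p q \<and> p \<in> C i \<and> q \<in> C i" for p q
    have viax: "R p x" "R x p" if "E x p" "p \<in> C i" "a \<in> B i" for p
      using that S(4)[OF that(1)] BC(2)[of i] by (simp_all add: R_def)
    have path: "R\<^sup>*\<^sup>* p q" if c: "contract E x a p q" and p: "p \<in> B i" and q: "q \<in> B i" for p q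
    proof -
      have pqC: "p \<in> C i" "q \<in> C i" using p q BC(1)[of i] by blast+
      from c consider "E p q" | "p = a" "E x q" | "q = a" "E x p" unfolding contract_def by blast
      then show ?thesis
      proof cases
        case 1
        with pqC have "R p q" by (simp add: R_def)
        then show ?thesis by (rule r_into_rtranclp)
      next
        case 2
        with pqC p xa have "R p x" "R x q" by (simp_all add: viax)
        then show ?thesis by (rule converse_rtranclp_into_rtranclp[OF _ r_into_rtranclp])
      next
        case 3
        with pqC q xa have "R p x" "R x q" by (simp_all add: viax)
        then show ?thesis by (rule converse_rtranclp_into_rtranclp[OF _ r_into_rtranclp])
      qed
    qed
    have BB: "R\<^sup>*\<^sup>* p q" if p: "p \<in> B i" and q: "q \<in> B i" for p q
    proof -
      have "(\<lambda>p q. contract E x a p q \<and> p \<in> B i \<and> q \<in> B i)\<^sup>*\<^sup>* p q"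
        by (rule B1(3)[OF i, unfolded connected_in_def, rule_format, OF p q])
      then show ?thesis
      proof (induction rule: rtranclp_induct)
        case (step y z)
        then have "R\<^sup>*\<^sup>* y z" by (intro path) simp_all
        with step.IH show ?case by (rule rtranclp_trans)
      qed simp
    qed
    have to: "R\<^sup>*\<^sup>* p a \<and> R\<^sup>*\<^sup>* a p" if p: "p \<in> C i" and a: "a \<in> B i" for p
    proof (cases "p = x")
      case True
      have "a \<in> C i" using a BC(1)[of i] by blast
      then have "R p a" "R a p" using viax[OF xa _ a] True by simp_all
      then show ?thesis by blast
    next
      case False
      with p BC(3)[of i] have "p \<in> B i" by blast
      then show ?thesis using BB a by blast
    qed
    have "R\<^sup>*\<^sup>* p q" if p: "p \<in> C i" and q: "q \<in> C i" for p q
    proof (cases "a \<in> B i")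
      case True
      have "R\<^sup>*\<^sup>* p a" "R\<^sup>*\<^sup>* a q" using to[OF p True] to[OF q True] by blast+
      then show ?thesis by (rule rtranclp_trans)
    next
      case False
      then show ?thesis using p q BB by (simp add: C_def)
    qed
    then show ?thesis unfolding connected_in_def R_def by blast
  qed
  have "C i \<inter> C j = {} \<and> (\<exists>p\<in>C i. \<exists>q\<in>C j. E p q)" if ij: "i < 4" "j < 4" "i \<noteq> j" for i j
  proof
    note b = B2[OF ij]
    have "x \<notin> C i \<or> x \<notin> C j" using b(1) xC[OF _ ij(1)] xC[OF _ ij(2)] by blast
    moreover have "x \<notin> B i" "x \<notin> B j" using B1(2)[OF ij(1)] B1(2)[OF ij(2)] by blast+
    ultimately show "C i \<inter> C j = {}" using b(1) BC(3)[of i] BC(3)[of j] by blast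
    from b(2) obtain p q where pq: "p \<in> B i" "q \<in> B j" "contract E x a p q" by blast
    then consider "E p q" | "p = a" "E x q" | "q = a" "E p x"
      unfolding contract_def using S(4)[of x p] by blast
    then show "\<exists>p\<in>C i. \<exists>q\<in>C j. E p q"
    proof cases
      case 1 then show ?thesis using pq(1,2) BC(1)[of i] BC(1)[of j] by blast
    next
      case 2 then show ?thesis using pq(1,2) BC(2)[of i] BC(1)[of j] by blast
    next
      case 3 then show ?thesis using pq(1,2) BC(1)[of i] BC(2)[of j] by blast
    qed
  qed
  moreover have "C i \<noteq> {}" "C i \<subseteq> V" if "i < 4" for i
    using B1(1,2)[OF that] BC(1,3)[of i] S(2)[OF xa] by blast+
  ultimately show ?thesis
    unfolding has_K4_minor_def using conn by (intro exI[of _ C] conjI allI impI) simp_all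
qed

lemma K4_minor_free_del:
  "K4_minor_free V E \<Longrightarrow> K4_minor_free (V - S) (del E S)"
  unfolding K4_minor_free_def using K4_minor_subgraph[of "V - S" "del E S" V E]
  by (auto simp: del_def)

text \<open>Replacing x by an edge between two of its neighbours gives a subgraph of the contraction
  of x into one of them.\<close>

lemma K4_minor_free_fill:
  assumes "simple_graph V E" "K4_minor_free V E" "E x a" "E x b" "a \<noteq> b"
  shows "simple_graph (V - {x}) (add_edge (del E {x}) a b)"
    and "K4_minor_free (V - {x}) (add_edge (del E {x}) a b)"
proof -
  note S = simple_graphD[OF assms(1)]
  have ab: "a \<noteq> x" "b \<noteq> x" "a \<in> V" "b \<in> V" using assms(3,4) S(3,5) by blast+
  show "simple_graph (V - {x}) (add_edge (del E {x}) a b)"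
    using ab assms(5) by (intro simple_add_edge simple_del assms(1)) auto
  have "contract E x a u w" if "add_edge (del E {x}) a b u w" for u w
    using that ab assms(4,5) S(5)[of u] by (auto simp: add_edge_def del_def contract_def)
  then show "K4_minor_free (V - {x}) (add_edge (del E {x}) a b)"
    using K4_minor_contract[OF assms(1,3)] K4_minor_subgraph[of "V - {x}" _ "V - {x}" "contract E x a"] assms(2)
    unfolding K4_minor_free_def by blast
qed

lemma reach_avoids: "(del E S)\<^sup>*\<^sup>* s y \<Longrightarrow> y = s \<or> y \<notin> S"
  by (induction rule: rtranclp_induct) (auto simp: del_def)

lemma reach_sym:
  assumes "simple_graph V E" "(del E S)\<^sup>*\<^sup>* u w"
  shows "(del E S)\<^sup>*\<^sup>* w u"
proof -
  have "symp (del E S)" using simple_graphD(4)[OF assms(1)] unfolding symp_def del_def by blast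
  then show ?thesis using assms(2) by (meson sympD symp_rtranclp)
qed

lemma connected_in_reach:
  assumes "simple_graph V E"
  shows "connected_in E {y. (del E S)\<^sup>*\<^sup>* s y}"
proof -
  define R where "R a b \<longleftrightarrow> E a b \<and> a \<in> {y. (del E S)\<^sup>*\<^sup>* s y} \<and> b \<in> {y. (del E S)\<^sup>*\<^sup>* s y}" for a b
  have sy: "R\<^sup>*\<^sup>* s y" if "(del E S)\<^sup>*\<^sup>* s y" for y
    using that
  proof (induction rule: rtranclp_induct)
    case (step y z)
    have "(del E S)\<^sup>*\<^sup>* s z" using step.hyps by (rule rtranclp.rtrancl_into_rtrancl)
    then have "R y z" using step.hyps by (simp add: R_def del_def)
    with step.IH show ?case by (rule rtranclp.rtrancl_into_rtrancl)
  qed simp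
  have "symp R" using simple_graphD(4)[OF assms] unfolding symp_def R_def by blast
  then have ys: "R\<^sup>*\<^sup>* y s" if "(del E S)\<^sup>*\<^sup>* s y" for y
    using sy[OF that] by (meson sympD symp_rtranclp)
  have "R\<^sup>*\<^sup>* p q" if "(del E S)\<^sup>*\<^sup>* s p" "(del E S)\<^sup>*\<^sup>* s q" for p q
    using ys[OF that(1)] sy[OF that(2)] by (rule rtranclp_trans)
  then show ?thesis unfolding connected_in_def R_def by simp
qed

text \<open>The branch sets are v, w, u1 and the component of u2 after removal of these three
  vertices. The first arrival at u1 of a walk from u2 gives the edge between the last two.\<close>

lemma K4_minor_of_theta:
  assumes G: "simple_graph V E" and vw: "E v w" and u: "E v u1" "E w u1" "E v u2" "E w u2" "u1 \<noteq> u2"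
    and reach: "(del E {v, w})\<^sup>*\<^sup>* u2 u1"
  shows "has_K4_minor V E"
proof -
  note S = simple_graphD[OF G]
  define C where "C = {y. (del E {v, w, u1})\<^sup>*\<^sup>* u2 y}"
  have CV: "y \<in> V \<and> y \<noteq> v \<and> y \<noteq> w \<and> y \<noteq> u1" if "y \<in> C" for y
  proof -
    from that have "(del E {v, w, u1})\<^sup>*\<^sup>* u2 y" by (simp add: C_def)
    then show ?thesis
      using u S(3)[OF u(3)] S(5)[of v] S(5)[of w]
      by (induction rule: rtranclp_induct) (auto simp: del_def dest: S(3))
  qed
  have u2C: "u2 \<in> C" by (simp add: C_def)
  have "p \<in> C \<or> (\<exists>c\<in>C. E c u1)" if "(del E {v, w})\<^sup>*\<^sup>* u2 p" for p
    using that
  proof (induction rule: rtranclp_induct)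
    case (step p q)
    show ?case
    proof (cases "p \<in> C \<and> q \<noteq> u1")
      case True
      then have "p \<noteq> u1" using CV by blast
      with True step.hyps(2) have "del E {v, w, u1} p q" by (simp add: del_def)
      with True have "q \<in> C" by (auto simp: C_def intro: rtranclp.rtrancl_into_rtrancl)
      then show ?thesis by blast
    next
      case False
      then show ?thesis using step by (auto simp: del_def)
    qed
  qed (simp add: u2C)
  from this[OF reach] obtain c where c: "c \<in> C" "E c u1" using CV by blast
  define B where "B i = [{v}, {w}, {u1}, C] ! i" for i :: nat
  have sing: "connected_in E {p}" for p by (simp add: connected_in_def)
  have conn: "connected_in E C" unfolding C_def by (rule connected_in_reach[OF G])
  have four: "i < 4 \<longleftrightarrow> i = 0 \<or> i = 1 \<or> i = 2 \<or> i = 3" for i :: nat by auto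
  have "\<forall>i<4. B i \<noteq> {} \<and> B i \<subseteq> V \<and> connected_in E (B i)"
    unfolding four using sing conn u2C CV S(2,3) vw u by (auto simp: B_def)
  moreover have "\<forall>i<4. \<forall>j<4. i \<noteq> j \<longrightarrow> B i \<inter> B j = {} \<and> (\<exists>a\<in>B i. \<exists>b\<in>B j. E a b)"
  proof -
    have E: "E v w" "E w v" "E v u1" "E u1 v" "E w u1" "E u1 w" "\<exists>b\<in>C. E v b" "\<exists>b\<in>C. E w b" "\<exists>b\<in>C. E u1 b"
      "\<exists>b\<in>C. E b v" "\<exists>b\<in>C. E b w" "\<exists>b\<in>C. E b u1"
      using vw u c u2C S(4) by blast+
    have D: "v \<noteq> w" "v \<noteq> u1" "w \<noteq> u1" "v \<notin> C" "w \<notin> C" "u1 \<notin> C"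
      using vw u S(5) CV by blast+
    show ?thesis
      unfolding four using E D by (auto simp: B_def)
  qed
  ultimately show ?thesis unfolding has_K4_minor_def by blast
qed

lemma card_ge_3_minus:
  assumes "3 \<le> card A" shows "2 \<le> card (A - {p})"
  using assms by (cases "finite A") (auto simp: card_Diff_singleton_if)

lemma nb_iff: "w \<in> nb E v \<longleftrightarrow> E v w"
  by (simp add: nb_def)

text \<open>Induction on the number of vertices. If some edge \<open>v w\<close> with \<open>v\<close> outside the root has two common
  neighbours, these are either joined by a path avoiding \<open>v\<close> and \<open>w\<close>, which gives a \<open>K4\<close>-minor, or one of
  the components of the rest misses \<open>{a, b}\<close> and can be rooted at \<open>v w\<close> instead. If some such edge lies in
  no triangle, contracting it keeps the degrees. Otherwise every such edge lies in exactly one triangle; then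
  every neighbourhood outside the root is perfectly matched, so that the degrees are at least 4 and any
  such edge can be contracted.\<close>

lemma K4_minor_of_degree_ge_3:
  assumes "simple_graph V E" "E a b" "V - {a, b} \<noteq> {}" "\<forall>v\<in>V - {a, b}. 3 \<le> card (nb E v)"
  shows "has_K4_minor V E"
  using assms
proof (induction "card V" arbitrary: V E a b rule: less_induct)
  case less
  note G = \<open>simple_graph V E\<close> and ab = \<open>E a b\<close> and ne = \<open>V - {a, b} \<noteq> {}\<close> and deg = less.prems(4)
  note S = simple_graphD[OF G]
  have abV: "a \<in> V" "b \<in> V" "a \<noteq> b" using ab S by blast+
  have finnb: "finite (nb E u)" for u by (rule finite_nb[OF G])
  show ?case
  proof (cases "\<exists>v w u1 u2. v \<in> V - {a, b} \<and> E v w \<and> u1 \<noteq> u2 \<and> E v u1 \<and> E w u1 \<and> E v u2 \<and> E w u2")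
    case True
    then obtain v w u1 u2 where v: "v \<in> V - {a, b}" and vw: "E v w"
      and u: "E v u1" "E w u1" "E v u2" "E w u2" "u1 \<noteq> u2" by blast
    define R where "R = (del E {v, w})\<^sup>*\<^sup>*"
    show ?thesis
    proof (cases "R u2 u1")
      case True
      then show ?thesis using K4_minor_of_theta[OF G vw u] by (simp add: R_def)
    next
      case False
      have Rsym: "R p q \<Longrightarrow> R q p" for p q unfolding R_def by (rule reach_sym[OF G])
      have Rtrans: "R p q \<Longrightarrow> R q r \<Longrightarrow> R p r" for p q r unfolding R_def by (rule rtranclp_trans)
      have nvw: "u1 \<noteq> v" "u1 \<noteq> w" "u2 \<noteq> v" "u2 \<noteq> w" using u S(5) by blast+
      have av: "p \<noteq> v \<and> p \<noteq> w" if "R u1 p \<or> R u2 p" for p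
        using that reach_avoids[of E "{v, w}" u1 p] reach_avoids[of E "{v, w}" u2 p] nvw
        unfolding R_def by blast
      \<comment> \<open>Since \<open>a\<close> and \<open>b\<close> are adjacent, whatever is left
        of them after removing \<open>v\<close> and \<open>w\<close> lies in a single
        component.\<close>
      have nR: "\<not> (p \<in> {a, b} \<and> q \<in> {a, b} \<and> R u1 p \<and> R u2 q)" for p q
      proof
        assume pq: "p \<in> {a, b} \<and> q \<in> {a, b} \<and> R u1 p \<and> R u2 q"
        then have "p = q \<or> E q p" using ab S(4) by blast
        moreover have "p \<noteq> v \<and> p \<noteq> w" "q \<noteq> v \<and> q \<noteq> w" using av pq by blast+
        ultimately have "p = q \<or> del E {v, w} q p" by (auto simp: del_def)
        then have "R q p" unfolding R_def by auto
        with pq False Rsym Rtrans show False by blast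
      qed
      \<comment> \<open>The component of \<open>s\<close> is to be kept, together with
        \<open>v\<close> and \<open>w\<close>; the vertex \<open>t\<close> lies outside, so the
        number of vertices drops.\<close>
      have "\<exists>s t. s \<in> V \<and> t \<in> V \<and> t \<notin> {v, w} \<and> \<not> R s t \<and> s \<notin> {v, w} \<and> (\<forall>p. R s p \<longrightarrow> p \<notin> {a, b})"
      proof (cases "\<exists>p\<in>{a, b}. R u1 p")
        case True
        then show ?thesis using nR False nvw S(3)[OF u(1)] S(3)[OF u(3)] by blast
      next
        case no: False
        then show ?thesis using False Rsym nvw S(3)[OF u(1)] S(3)[OF u(3)] by blast
      qed
      then obtain s t where s: "s \<in> V" "s \<notin> {v, w}" "\<forall>p. R s p \<longrightarrow> p \<notin> {a, b}"
        and t: "t \<in> V" "t \<notin> {v, w}" "\<not> R s t" by blast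
      have wV: "v \<in> V" "w \<in> V" using vw S by blast+
      define W where "W = {p. R s p} \<union> {v, w}"
      have RsV: "p \<in> V \<and> p \<notin> {v, w}" if "R s p" for p
        using that s(1,2) unfolding R_def by (induction rule: rtranclp_induct) (auto simp: del_def dest: S(3))
      have WV: "W \<subseteq> V" using RsV wV by (auto simp: W_def)
      have "t \<notin> W" using t by (simp add: W_def)
      then have "card W < card V" using WV t(1) S(1) by (intro psubset_card_mono) auto
      moreover have "simple_graph W (del E (V - W))"
        using simple_del[OF G, of "V - W"] WV by (simp add: double_diff)
      moreover have "del E (V - W) v w" using vw by (simp add: del_def W_def)
      moreover have "W - {v, w} \<noteq> {}"
      proof -
        have "R s s" by (simp add: R_def)
        then show ?thesis using s(2) by (auto simp: W_def)
      qed
      moreover have "\<forall>y\<in>W - {v, w}. 3 \<le> card (nb (del E (V - W)) y)"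
      proof
        fix y assume "y \<in> W - {v, w}"
        then have y: "R s y" "y \<in> W" "y \<notin> {v, w}" by (auto simp: W_def)
        have "z \<in> W" if "E y z" for z
        proof (cases "z \<in> {v, w}")
          case False
          with that y(3) have "del E {v, w} y z" by (simp add: del_def)
          with y(1) have "R s z" unfolding R_def by (rule rtranclp.rtrancl_into_rtrancl)
          then show ?thesis by (simp add: W_def)
        qed (auto simp: W_def)
        then have "nb (del E (V - W)) y = nb E y"
          using y(2) by (auto simp: nb_def del_def)
        moreover have "y \<in> V - {a, b}" using s(3) y(1) RsV by blast
        ultimately show "3 \<le> card (nb (del E (V - W)) y)" using deg by simp
      qed
      ultimately have "has_K4_minor W (del E (V - W))" by (rule less.hyps)
      then show ?thesis by (rule K4_minor_subgraph) (use WV in \<open>auto simp: del_def\<close>)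
    qed
  next
    case uniq: False
    have "\<exists>v w. v \<in> V - {a, b} \<and> E v w \<and> ((\<forall>u. \<not> (E v u \<and> E w u)) \<or> (\<forall>u\<in>V - {a, b}. 4 \<le> card (nb E u)))"
    proof (cases "\<exists>v w. v \<in> V - {a, b} \<and> E v w \<and> (\<forall>u. \<not> (E v u \<and> E w u))")
      case False
      \<comment> \<open>If there were exactly three neighbours, each would be adjacent to exactly
        one of the other two: a perfect matching on three points.\<close>
      have "4 \<le> card (nb E v)" if v: "v \<in> V - {a, b}" for v
      proof (rule ccontr)
        assume "\<not> ?thesis"
        then have "card (nb E v) = 3" using deg v by force
        then obtain p q r where N: "nb E v = {p, q, r}" and d: "p \<noteq> q" "p \<noteq> r" "q \<noteq> r"
          by (auto simp: card_3_iff)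
        have Ev: "E v y \<longleftrightarrow> y = p \<or> y = q \<or> y = r" for y using N nb_iff[of y E v] by auto
        have partner: "\<exists>u. (u = p \<or> u = q \<or> u = r) \<and> E y u" if "y = p \<or> y = q \<or> y = r" for y
          using False v that Ev by metis
        have once: "u1 = u2" if "y = p \<or> y = q \<or> y = r" "u1 = p \<or> u1 = q \<or> u1 = r" "u2 = p \<or> u2 = q \<or> u2 = r"
          "E y u1" "E y u2" for y u1 u2
          using uniq v that Ev by metis
        have "E p q \<or> E p r" "E q p \<or> E q r" "E r p \<or> E r q"
          using partner[of p] partner[of q] partner[of r] S(5) by blast+
        moreover have "\<not> (E p q \<and> E p r)" "\<not> (E q p \<and> E q r)" "\<not> (E r p \<and> E r q)"
          using once[of p q r] once[of q p r] once[of r p q] d by blast+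
        ultimately show False using S(4) by blast
      qed
      moreover obtain v where v: "v \<in> V - {a, b}" using ne by blast
      moreover have "nb E v \<noteq> {}"
      proof
        assume "nb E v = {}"
        moreover have "3 \<le> card (nb E v)" using deg v by blast
        ultimately show False by simp
      qed
      ultimately show ?thesis unfolding nb_def by blast
    qed blast
    then obtain v w where v: "v \<in> V - {a, b}" and vw: "E v w"
      and alt: "(\<forall>u. \<not> (E v u \<and> E w u)) \<or> (\<forall>u\<in>V - {a, b}. 4 \<le> card (nb E u))" by blast
    have wv: "w \<noteq> v" "w \<in> V" using vw S by blast+
    let ?E = "contract E v w"
    have nbsub: "nb ?E u \<subseteq> V" for u
      using simple_graphD(3)[OF simple_contract[OF G vw]] by (auto simp: nb_def)
    have fin': "finite (nb ?E u)" for u by (rule finite_subset[OF nbsub S(1)])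
    have "card (V - {v}) < card V" using v S(1) by (intro psubset_card_mono) auto
    moreover have "simple_graph (V - {v}) ?E" by (rule simple_contract[OF G vw])
    moreover have "?E a b" using ab abV v by (auto simp: contract_def)
    moreover have "V - {v} - {a, b} \<noteq> {}"
    proof -
      have "\<not> nb E v \<subseteq> {a, b}"
      proof
        assume "nb E v \<subseteq> {a, b}"
        then have "card (nb E v) \<le> card {a, b}" by (intro card_mono) auto
        also have "\<dots> \<le> 2" by (simp add: card_insert_if)
        finally show False using deg v by force
      qed
      then obtain s where "E v s" "s \<notin> {a, b}" by (auto simp: nb_def)
      then have "s \<in> V" "s \<noteq> v" using S by blast+
      with \<open>s \<notin> {a, b}\<close> show ?thesis by blast
    qed
    moreover have "\<forall>u\<in>V - {v} - {a, b}. 3 \<le> card (nb ?E u)"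
    proof
      fix u assume u: "u \<in> V - {v} - {a, b}"
      show "3 \<le> card (nb ?E u)"
      proof (cases "u = w")
        case True
        have sub: "(nb E w - {v}) \<union> (nb E v - {w}) \<subseteq> nb ?E w"
          using S(5)[of w] S(5)[of v] wv by (auto simp: nb_def contract_def)
        \<comment> \<open>Without common neighbours each side contributes at least two; otherwise
          all degrees outside the root are at least 4 and the side of \<open>v\<close>
          suffices.\<close>
        have "3 \<le> card ((nb E w - {v}) \<union> (nb E v - {w}))"
        proof (cases "\<forall>u. \<not> (E v u \<and> E w u)")
          case True
          then have "card ((nb E w - {v}) \<union> (nb E v - {w})) = card (nb E w - {v}) + card (nb E v - {w})"
            by (intro card_Un_disjoint) (auto simp: nb_def finnb[unfolded nb_def])
          moreover have "2 \<le> card (nb E w - {v})" "2 \<le> card (nb E v - {w})"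
            using deg v u \<open>u = w\<close> by (auto intro!: card_ge_3_minus)
          ultimately show ?thesis by linarith
        next
          case False
          with alt v have "4 \<le> card (nb E v)" by blast
          then have "3 \<le> card (nb E v - {w})" using vw finnb[of v] by (simp add: nb_def)
          also have "\<dots> \<le> card ((nb E w - {v}) \<union> (nb E v - {w}))"
            using finnb by (intro card_mono) auto
          finally show ?thesis .
        qed
        also have "\<dots> \<le> card (nb ?E w)" by (rule card_mono[OF fin' sub])
        finally show ?thesis using True by simp
      next
        case uw: False
        show ?thesis
        proof (cases "E u v")
          case False
          have "nb E u \<subseteq> nb ?E u"
            using False u S(5)[of u] by (auto simp: nb_def contract_def)
          then have "card (nb E u) \<le> card (nb ?E u)" by (rule card_mono[OF fin'])
          moreover have "3 \<le> card (nb E u)" using deg u by blast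
          ultimately show ?thesis by linarith
        next
          case uv: True
          then have vu: "E v u" by (rule S(4))
          have sub: "insert w (nb E u - {v}) \<subseteq> nb ?E u"
            using uw vu u wv S(5)[of u] by (auto simp: nb_def contract_def)
          have "3 \<le> card (insert w (nb E u - {v}))"
          proof (cases "E w u")
            case True
            with vu alt u have "4 \<le> card (nb E u)" by blast
            then have "3 \<le> card (nb E u - {v})" using uv finnb[of u] by (simp add: nb_def)
            also have "\<dots> \<le> card (insert w (nb E u - {v}))" using finnb[of u] by (intro card_mono) auto
            finally show ?thesis .
          next
            case False
            then have "w \<notin> nb E u" using S(4) by (auto simp: nb_def)
            then have "card (insert w (nb E u - {v})) = card (nb E u - {v}) + 1"
              using finnb[of u] by simp
            moreover have "2 \<le> card (nb E u - {v})" using deg u by (intro card_ge_3_minus) blast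
            ultimately show ?thesis by linarith
          qed
          also have "\<dots> \<le> card (nb ?E u)" by (rule card_mono[OF fin' sub])
          finally show ?thesis .
        qed
      qed
    qed
    ultimately have "has_K4_minor (V - {v}) ?E" by (rule less.hyps)
    then show ?thesis by (rule K4_minor_contract[OF G vw])
  qed
qed

section \<open>Vertices of degree at most 2 in K4-minor-free graphs\<close>

lemma degree_le_2_outside_edge:
  assumes "simple_graph V E" "K4_minor_free V E" "E a b" "V - {a, b} \<noteq> {}"
  shows "\<exists>v\<in>V - {a, b}. card (nb E v) \<le> 2"
proof (rule ccontr)
  assume no: "\<not> (\<exists>v\<in>V - {a, b}. card (nb E v) \<le> 2)"
  have "3 \<le> card (nb E v)" if "v \<in> V - {a, b}" for v
  proof -
    have "\<not> card (nb E v) \<le> 2" using no that by blast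
    then show ?thesis by linarith
  qed
  then have "has_K4_minor V E" by (intro K4_minor_of_degree_ge_3[OF assms(1,3,4)] ballI)
  with assms(2) show False by (simp add: K4_minor_free_def)
qed

lemma degree_le_2:
  assumes "simple_graph V E" "K4_minor_free V E" "V \<noteq> {}"
  shows "\<exists>v\<in>V. card (nb E v) \<le> 2"
proof (cases "\<exists>a b. E a b")
  case False
  then have "nb E v = {}" for v by (auto simp: nb_def)
  then show ?thesis using assms(3) by auto
next
  case True
  then obtain a b where ab: "E a b" by blast
  show ?thesis
  proof (cases "V - {a, b} = {}")
    case True
    have "nb E a \<subseteq> {a, b}" using True simple_graphD(3)[OF assms(1)] by (auto simp: nb_def)
    then have "card (nb E a) \<le> card {a, b}" by (intro card_mono) auto
    also have "\<dots> \<le> 2" by (simp add: card_insert_if)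
    finally show ?thesis using simple_graphD(2)[OF assms(1) ab] by blast
  next
    case False
    then show ?thesis using degree_le_2_outside_edge[OF assms(1,2) ab] by blast
  qed
qed

lemma nb_del_nonadjacent: "\<not> E v u \<Longrightarrow> u \<noteq> v \<Longrightarrow> simple_graph V E \<Longrightarrow> nb (del E {v}) u = nb E u"
  using simple_graphD(4)[of V E u v] by (auto simp: nb_def del_def)

lemma degree_le_2_outside_vertex:
  assumes "simple_graph V E" "K4_minor_free V E" "V - {a} \<noteq> {}"
  shows "\<exists>v\<in>V - {a}. card (nb E v) \<le> 2"
proof (cases "nb E a = {}")
  case True
  obtain v where v: "v \<in> V - {a}" "card (nb (del E {a}) v) \<le> 2"
    using degree_le_2[OF simple_del[OF assms(1)] K4_minor_free_del[OF assms(2)] assms(3)] by blast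
  have "\<not> E a v" using True by (auto simp: nb_def)
  then have "nb (del E {a}) v = nb E v" using v(1) by (intro nb_del_nonadjacent[OF _ _ assms(1)]) auto
  with v show ?thesis by auto
next
  case False
  then obtain b where ab: "E a b" by (auto simp: nb_def)
  note S = simple_graphD[OF assms(1)]
  show ?thesis
  proof (cases "V - {a, b} = {}")
    case True
    have "nb E b \<subseteq> {a, b}" using True S(3) by (auto simp: nb_def)
    then have "card (nb E b) \<le> card {a, b}" by (intro card_mono) auto
    also have "\<dots> \<le> 2" by (simp add: card_insert_if)
    finally show ?thesis using S(3)[OF ab] S(5)[of a] ab by blast
  next
    case False
    then show ?thesis using degree_le_2_outside_edge[OF assms(1,2) ab] by blast
  qed
qed

lemma card_le_2_cases:
  assumes "finite A" "card A \<le> 2"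
  obtains "A = {}" | a where "A = {a}" | a b where "A = {a, b}" "a \<noteq> b"
proof -
  from assms(2) consider "card A = 0" | "card A = 1" | "card A = 2" by linarith
  then show ?thesis
  proof cases
    case 1 with assms(1) that(1) show ?thesis by simp
  next
    case 2 then show ?thesis using that(2) by (meson card_1_singletonE)
  next
    case 3 with that(3) show ?thesis by (auto simp: card_2_iff)
  qed
qed

text \<open>Remove a vertex v of degree at most 2 and, if it has two neighbours, join them. Rooted
  at the neighbours of v, the rest has a second vertex of small degree that is not adjacent to v, so
  its degree is the same in the whole graph. This breaks down only if v is adjacent to all other
  vertices, and then there are at most three.\<close>

lemma two_vertices_degree_le_2:
  assumes G: "simple_graph V E" and K: "K4_minor_free V E" and ne: "V \<noteq> {}"
  shows "(\<exists>u\<in>V. \<exists>v\<in>V. u \<noteq> v \<and> \<not> E u v \<and> card (nb E u) \<le> 2 \<and> card (nb E v) \<le> 2)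
    \<or> (card V \<le> 3 \<and> (\<forall>u\<in>V. \<forall>v\<in>V. u \<noteq> v \<longrightarrow> E u v))"
proof -
  note S = simple_graphD[OF G]
  obtain v where v: "v \<in> V" "card (nb E v) \<le> 2" using degree_le_2[OF G K ne] by blast
  have finnb: "finite (nb E u)" for u by (rule finite_nb[OF G])
  show ?thesis
  proof (cases "V - {v} - nb E v = {}")
    case True
    then have "V \<subseteq> insert v (nb E v)" by blast
    then have "card V \<le> card (insert v (nb E v))" using finnb by (intro card_mono) auto
    also have "\<dots> \<le> 3" using v(2) finnb[of v] by (simp add: card_insert_if)
    finally have c: "card V \<le> 3" .
    have "card (nb E u) \<le> 2" if "u \<in> V" for u
    proof -
      have "nb E u \<subseteq> V - {u}" using S(3,5) by (auto simp: nb_def)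
      then have "card (nb E u) \<le> card (V - {u})" using S(1) by (intro card_mono) auto
      also have "\<dots> \<le> 2" using c that S(1) by simp
      finally show ?thesis .
    qed
    then show ?thesis using c by blast
  next
    case False
    have "\<exists>u\<in>V. u \<noteq> v \<and> \<not> E v u \<and> card (nb E u) \<le> 2"
      using finnb[of v] v(2)
    proof (cases rule: card_le_2_cases)
      case 1
      obtain u where u: "u \<in> V - {v}" "card (nb (del E {v}) u) \<le> 2"
        using degree_le_2[OF simple_del[OF G] K4_minor_free_del[OF K], of "{v}"] False by blast
      have "\<not> E v u" using 1 by (auto simp: nb_def)
      with u show ?thesis using nb_del_nonadjacent[OF _ _ G, of v u] by auto
    next
      case (2 a)
      obtain u where u: "u \<in> V - {v} - {a}" "card (nb (del E {v}) u) \<le> 2"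
        using degree_le_2_outside_vertex[OF simple_del[OF G] K4_minor_free_del[OF K], of "{v}" a] False 2 by blast
      have "u \<notin> nb E v" using u 2 by auto
      then have "\<not> E v u" by (auto simp: nb_def)
      with u show ?thesis using nb_del_nonadjacent[OF _ _ G, of v u] by auto
    next
      case (3 a b)
      then have ab: "E v a" "E v b" using nb_iff[of a E v] nb_iff[of b E v] by auto
      let ?F = "add_edge (del E {v}) a b"
      have "?F a b" by (simp add: add_edge_def)
      then obtain u where u: "u \<in> V - {v} - {a, b}" "card (nb ?F u) \<le> 2"
        using degree_le_2_outside_edge[OF K4_minor_free_fill[OF G K ab 3(2)], of a b] False 3(1) by blast
      have "u \<notin> nb E v" using u 3 by auto
      then have n: "\<not> E v u" by (auto simp: nb_def)
      have "nb ?F u = nb (del E {v}) u" using u by (auto simp: nb_def add_edge_def)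
      with u n show ?thesis using nb_del_nonadjacent[OF n _ G] by auto
    qed
    then show ?thesis using v S(4) by blast
  qed
qed

text \<open>Greedy colouring: a vertex of degree at most 2, put back last, finds a free
  colour.\<close>

lemma ex_proper_3_coloring:
  assumes "simple_graph V E" "K4_minor_free V E"
  shows "\<exists>c. proper_3_coloring V E c"
  using assms
proof (induction "card V" arbitrary: V E rule: less_induct)
  case less
  note G = less.prems(1) and K = less.prems(2)
  note S = simple_graphD[OF G]
  show ?case
  proof (cases "V = {}")
    case True
    then have "\<not> E u v" for u v using S(2) by blast
    then have "proper_3_coloring V E (\<lambda>_. 1)" by (simp add: proper_3_coloring_def)
    then show ?thesis by blast
  next
    case False
    then obtain v where v: "v \<in> V" "card (nb E v) \<le> 2" using degree_le_2[OF G K] by blast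
    have "card (V - {v}) < card V" using v S(1) by (intro psubset_card_mono) auto
    then obtain c where c: "proper_3_coloring (V - {v}) (del E {v}) c"
      using less.hyps simple_del[OF G] K4_minor_free_del[OF K] by blast
    have "card (c ` nb E v) \<le> 2"
      using v(2) card_image_le[OF finite_nb[OF G], of c v] by linarith
    moreover have "card {1, 2, 3 :: nat} = 3" by simp
    ultimately have "\<not> {1, 2, 3} \<subseteq> c ` nb E v"
      using card_mono[OF finite_imageI[OF finite_nb[OF G]], of "{1, 2, 3}" c v] by linarith
    then obtain k where k: "k \<in> {1, 2, 3}" "k \<notin> c ` nb E v" by blast
    have "proper_3_coloring V E (c(v := k))"
      unfolding proper_3_coloring_def
    proof (intro conjI ballI allI impI)
      fix u assume "u \<in> V"
      then show "(c(v := k)) u \<in> {1, 2, 3}" using c k(1) by (auto simp: proper_3_coloring_def)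
    next
      fix p q assume pq: "E p q"
      have kn: "k \<noteq> c r" if "E v r" for r using k(2) that by (auto simp: nb_def)
      show "(c(v := k)) p \<noteq> (c(v := k)) q"
      proof (cases "p = v \<or> q = v")
        case True
        then show ?thesis
        proof
          assume "p = v"
          with kn[of q] pq S(5)[of v] show ?thesis by auto
        next
          assume "q = v"
          with kn[of p] S(4)[OF pq] S(5)[of v] show ?thesis by auto
        qed
      next
        case False
        then have "del E {v} p q" using pq by (simp add: del_def)
        then show ?thesis using c False by (simp add: proper_3_coloring_def)
      qed
    qed
    then show ?thesis by blast
  qed
qed

section \<open>Diamonds and feasible triples\<close>

text \<open>A single link of a chain. The ends \<open>a\<close> and \<open>d\<close> may coincide,
  as chains are only homomorphic images; chains of arbitrary length are given by the reflexive
  transitive closure.\<close>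

definition diamond :: "('a \<Rightarrow> 'a \<Rightarrow> bool) \<Rightarrow> 'a \<Rightarrow> 'a \<Rightarrow> bool" where
  "diamond E a d \<longleftrightarrow> (\<exists>b c. E a b \<and> E a c \<and> E b c \<and> E b d \<and> E c d)"

text \<open>Feasibility for triples of not necessarily distinct vertices.\<close>

definition feasible_triple :: "'a set \<Rightarrow> ('a \<Rightarrow> 'a \<Rightarrow> bool) \<Rightarrow> 'a \<Rightarrow> 'a \<Rightarrow> 'a \<Rightarrow> bool" where
  "feasible_triple V E x y z \<longleftrightarrow> \<not> ((diamond E)\<^sup>*\<^sup>* x y \<and> (diamond E)\<^sup>*\<^sup>* y z)
     \<and> (\<exists>c. proper_3_coloring V E c \<and> (c x = c y \<or> c x = c z \<or> c y = c z))"

lemma diamonds_mono: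
  assumes "(diamond E')\<^sup>*\<^sup>* a d" "\<And>u v. E' u v \<Longrightarrow> E u v"
  shows "(diamond E)\<^sup>*\<^sup>* a d"
proof -
  have "diamond E' \<le> diamond E"
    using assms(2) unfolding diamond_def by (intro predicate2I) blast
  then show ?thesis using assms(1) rtranclp_mono by blast
qed

lemma diamonds_del: "(diamond (del E S))\<^sup>*\<^sup>* a d \<Longrightarrow> (diamond E)\<^sup>*\<^sup>* a d"
  by (erule diamonds_mono) (simp add: del_def)

lemma diamonds_sym:
  assumes "simple_graph V E" "(diamond E)\<^sup>*\<^sup>* a d"
  shows "(diamond E)\<^sup>*\<^sup>* d a"
proof -
  have "symp (diamond E)"
    using simple_graphD(4)[OF assms(1)] unfolding symp_def diamond_def by blast
  then show ?thesis using assms(2) by (meson sympD symp_rtranclp)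
qed

lemma coloring_neq: "proper_3_coloring V E c \<Longrightarrow> E u v \<Longrightarrow> c u \<noteq> c v"
  by (simp add: proper_3_coloring_def)

lemma coloring_values: "proper_3_coloring V E c \<Longrightarrow> v \<in> V \<Longrightarrow> c v = 1 \<or> c v = 2 \<or> c v = 3"
  by (simp add: proper_3_coloring_def)

lemma coloring_mono:
  assumes "proper_3_coloring V E c" "V' \<subseteq> V" "\<And>u v. E' u v \<Longrightarrow> E u v"
  shows "proper_3_coloring V' E' c"
  using assms unfolding proper_3_coloring_def by blast

lemma coloring_del: "proper_3_coloring V E c \<Longrightarrow> proper_3_coloring (V - S) (del E S) c"
  by (erule coloring_mono) (simp_all add: del_def Diff_subset)

text \<open>Both ends of a diamond avoid the two colours of its middle edge, which leaves one
  colour.\<close>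

lemma diamonds_same_color:
  assumes "simple_graph V E" "proper_3_coloring V E c" "(diamond E)\<^sup>*\<^sup>* a d"
  shows "c a = c d"
  using assms(3)
proof (induction rule: rtranclp_induct)
  case (step d e)
  then obtain u v where "E d u" "E d v" "E u v" "E u e" "E v e" unfolding diamond_def by blast
  moreover from this have "d \<in> V" "u \<in> V" "v \<in> V" "e \<in> V"
    using simple_graphD(2,3)[OF assms(1)] by blast+
  ultimately have "c d = c e"
    using coloring_neq[OF assms(2), of d u] coloring_neq[OF assms(2), of d v] coloring_neq[OF assms(2), of u v]
      coloring_neq[OF assms(2), of u e] coloring_neq[OF assms(2), of v e]
      coloring_values[OF assms(2), of d] coloring_values[OF assms(2), of u]
      coloring_values[OF assms(2), of v] coloring_values[OF assms(2), of e] by metis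
  with step.IH show ?case by simp
qed simp

lemma feasible_triple_of_coloring:
  assumes "simple_graph V E" "proper_3_coloring V E c"
    and "\<not> (c x = c y \<and> c y = c z)" "c x = c y \<or> c x = c z \<or> c y = c z"
  shows "feasible_triple V E x y z"
  unfolding feasible_triple_def using diamonds_same_color[OF assms(1,2)] assms(2-4) by blast

lemma feasible_triple_swap:
  assumes "simple_graph V E" "feasible_triple V E x y z"
  shows "feasible_triple V E y x z" "feasible_triple V E x z y"
proof -
  note sym = diamonds_sym[OF assms(1)]
  have tr: "(diamond E)\<^sup>*\<^sup>* a c" if "(diamond E)\<^sup>*\<^sup>* a b" "(diamond E)\<^sup>*\<^sup>* b c" for a b c
    using that by (rule rtranclp_trans)
  have "\<not> ((diamond E)\<^sup>*\<^sup>* y x \<and> (diamond E)\<^sup>*\<^sup>* x z)" "\<not> ((diamond E)\<^sup>*\<^sup>* x z \<and> (diamond E)\<^sup>*\<^sup>* z y)"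
    using assms(2) sym[of y x] sym[of z y] tr[of y x z] tr[of x z y] unfolding feasible_triple_def by blast+
  moreover obtain c where "proper_3_coloring V E c" "c x = c y \<or> c x = c z \<or> c y = c z"
    using assms(2) unfolding feasible_triple_def by blast
  then have "\<exists>c. proper_3_coloring V E c \<and> (c y = c x \<or> c y = c z \<or> c x = c z)"
    "\<exists>c. proper_3_coloring V E c \<and> (c x = c z \<or> c x = c y \<or> c z = c y)"
    by metis+
  ultimately show "feasible_triple V E y x z" "feasible_triple V E x z y"
    unfolding feasible_triple_def by blast+
qed

lemma feasible_triple_del:
  assumes "feasible_triple V E x y z"
  shows "feasible_triple (V - S) (del E S) x y z"
  using assms diamonds_del[of E S] coloring_del[of V E _ S] unfolding feasible_triple_def by blast

lemma chain_of_diamonds: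
  assumes G: "simple_graph V E" and X: "x \<in> V"
    and xy: "(diamond E)\<^sup>*\<^sup>* x y" and yz: "(diamond E)\<^sup>*\<^sup>* y z"
  shows "connected_by_chain_of_diamonds V E {x, y, z}"
proof -
  note S = simple_graphD[OF G]
  obtain m f where f: "f 0 = x" "f m = y" "\<forall>i<m. diamond E (f i) (f (Suc i))"
    using xy unfolding rtranclp_power relpowp_fun_conv by blast
  obtain n g where g: "g 0 = y" "g n = z" "\<forall>i<n. diamond E (g i) (g (Suc i))"
    using yz unfolding rtranclp_power relpowp_fun_conv by blast
  define u where "u i = (if i \<le> m then f i else g (i - m))" for i
  have u: "u 0 = x" "u m = y" "u (m + n) = z"
    using f g by (auto simp: u_def)
  have step: "diamond E (u i) (u (Suc i))" if i: "i < m + n" for i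
  proof -
    consider "i < m" | "i = m" "0 < n" | "m < i" "i - m < n"
      using i by linarith
    then show ?thesis
    proof cases
      case 1 then show ?thesis using f(3) by (simp add: u_def)
    next
      case 2 then show ?thesis using f(2) g(1,3) by (auto simp: u_def)
    next
      case 3
      then have "Suc i - m = Suc (i - m)" by simp
      then show ?thesis using 3 g(3) by (simp add: u_def)
    qed
  qed
  have "\<exists>b c. i < m + n \<longrightarrow> E (u i) b \<and> E (u i) c \<and> E b c \<and> E b (u (Suc i)) \<and> E c (u (Suc i))" for i
    using step[of i] unfolding diamond_def by blast
  then obtain b c where bc: "\<And>i. i < m + n \<Longrightarrow>
      E (u i) (b i) \<and> E (u i) (c i) \<and> E (b i) (c i) \<and> E (b i) (u (Suc i)) \<and> E (c i) (u (Suc i))"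
    by metis
  \<comment> \<open>The link from \<open>u (i - 1)\<close> to \<open>u i\<close> has its middle
    vertices stored at index \<open>i - 1\<close>, whereas the chain of diamonds numbers them
    \<open>i\<close>.\<close>
  define \<phi> where "\<phi> a = (case a of DU i \<Rightarrow> u i | DV i \<Rightarrow> b (i - 1) | DW i \<Rightarrow> c (i - 1))" for a
  have edge: "E (\<phi> p) (\<phi> q)" if "(p, q) \<in> diamond_edges0 (m + n)" for p q
  proof -
    from that obtain i where i: "i \<in> {1..m + n}" and pq: "(p, q) \<in> {(DU (i - 1), DV i), (DU (i - 1), DW i),
        (DV i, DW i), (DV i, DU i), (DW i, DU i)}"
      unfolding diamond_edges0_def by blast
    have "i - 1 < m + n" "Suc (i - 1) = i" using i by auto
    with bc[of "i - 1"] pq show ?thesis by (auto simp: \<phi>_def)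
  qed
  have uV: "u i \<in> V" if "i \<le> m + n" for i
  proof (cases "i = 0")
    case False
    then show ?thesis using bc[of "i - 1"] that S(3) by (metis Suc_pred' le_neq_implies_less less_Suc_eq_le not_gr_zero not_less_eq_eq order_less_le_trans lessI)
  qed (simp add: u X)
  have bV: "b (i - 1) \<in> V" "c (i - 1) \<in> V" if "1 \<le> i" "i \<le> m + n" for i
  proof -
    have "i - 1 < m + n" using that by linarith
    from bc[OF this] show "b (i - 1) \<in> V" "c (i - 1) \<in> V" using S(3) by blast+
  qed
  have "\<forall>a\<in>diamond_verts (m + n). \<phi> a \<in> V"
    unfolding diamond_verts_def using uV bV by (auto simp: \<phi>_def)
  moreover have "E (\<phi> p) (\<phi> q)" if "diamond_adj (m + n) p q" for p q
    using that edge[of p q] edge[of q p] S(4) unfolding diamond_adj_def by blast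
  moreover have "{x, y, z} \<subseteq> \<phi> ` (DU ` {0..m + n})"
  proof -
    have "u i \<in> \<phi> ` (DU ` {0..m + n})" if "i \<le> m + n" for i
      using that by (intro image_eqI[of _ \<phi> "DU i"]) (auto simp: \<phi>_def)
    from this[of 0] this[of m] this[of "m + n"] show ?thesis by (simp add: u)
  qed
  ultimately show ?thesis
    unfolding connected_by_chain_of_diamonds_def graph_hom_def by blast
qed

lemma feasible_triple_of_feasible:
  assumes "simple_graph V E" "x \<noteq> y" "x \<noteq> z" "y \<noteq> z" "feasible V E {x, y, z}"
  shows "feasible_triple V E x y z"
proof -
  from assms(5) obtain c where c: "proper_3_coloring V E c" "card (c ` {x, y, z}) \<le> 2"
    and nc: "\<not> connected_by_chain_of_diamonds V E {x, y, z}" and xV: "x \<in> V"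
    unfolding feasible_def by auto
  have "c x = c y \<or> c x = c z \<or> c y = c z"
  proof (rule ccontr)
    assume "\<not> ?thesis"
    then have "card (c ` {x, y, z}) = 3" by simp
    with c(2) show False by simp
  qed
  with c(1) nc chain_of_diamonds[OF assms(1) xV] show ?thesis
    unfolding feasible_triple_def by blast
qed

section \<open>Minimal counterexamples\<close>

lemma cubes_coeffs:
  assumes "q \<in> cubes" "q = Var v ^ 3 * r + Var v ^ 2 * p2 + Var v * p1 + p0"
    and "var_free v p0" "var_free v p1" "var_free v p2"
  shows "p0 \<in> cubes" "p1 \<in> cubes" "p2 \<in> cubes"
  using cubes_extract[of v r p2 p1 p0] assms by auto

text \<open>The three edge factors form the Vandermonde determinant in x_a, x_b, x_c. Its products
  with the first and second elementary symmetric polynomials are the alternants with exponents 0, 1,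
  3 and 0, 2, 3, and every term of these contains a cube.\<close>

lemma graph_poly_triangle:
  assumes G: "simple_graph V E" and t: "E a b" "E b c" "E a c"
  shows "(Var a + Var b + Var c) * graph_poly E \<in> cubes"
    and "(Var a * Var b + Var b * Var c + Var c * Var a) * graph_poly E \<in> cubes"
proof -
  note S = simple_graphD[OF G]
  have d: "a \<noteq> b" "b \<noteq> c" "a \<noteq> c" using t S(5) by blast+
  have "{{a, b}, {b, c}, {a, c}} \<subseteq> edge_set E"
    using t by (auto simp: edge_set_def)
  then have "graph_poly E = (\<Prod>e\<in>edge_set E - {{a, b}, {b, c}, {a, c}}. \<Sum>v\<in>e. Var v)
      * (\<Prod>e\<in>{{a, b}, {b, c}, {a, c}}. \<Sum>v\<in>e. Var v)"
    unfolding graph_poly_def by (rule prod.subset_diff[OF _ finite_edge_set[OF G]])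
  also have "(\<Prod>e\<in>{{a, b}, {b, c}, {a, c}}. \<Sum>v\<in>e. Var v)
      = (Var a + Var b) * ((Var b + Var c) * (Var a + Var c))"
    using d by (simp add: doubleton_eq_iff)
  finally obtain r where r: "graph_poly E = r * ((Var a + Var b) * ((Var b + Var c) * (Var a + Var c)))" by blast
  have C: "p * (Var a ^ 3) + q * (Var b ^ 3) + s * (Var c ^ 3) \<in> cubes" for p q s
    by (intro cubes_add cubes_mult Var_cube)
  have "(Var a + Var b + Var c) * graph_poly E
    = (r * (Var b + Var c)) * Var a ^ 3 + (r * (Var a + Var c)) * Var b ^ 3 + (r * (Var a + Var b)) * Var c ^ 3"
    unfolding r by (simp add: algebra_simps power3_eq_cube)
  with C show "(Var a + Var b + Var c) * graph_poly E \<in> cubes" by simp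
  have "(Var a * Var b + Var b * Var c + Var c * Var a) * graph_poly E
    = (r * (Var b ^ 2 + Var c ^ 2)) * Var a ^ 3 + (r * (Var a ^ 2 + Var c ^ 2)) * Var b ^ 3
      + (r * (Var a ^ 2 + Var b ^ 2)) * Var c ^ 3"
    unfolding r by (simp add: algebra_simps power3_eq_cube power2_eq_square)
  with C show "(Var a * Var b + Var b * Var c + Var c * Var a) * graph_poly E \<in> cubes" by simp
qed

lemma graph_poly_degree:
  assumes "simple_graph V E"
  shows "nb E v = {} \<Longrightarrow> graph_poly E = graph_poly (del E {v})"
    and "nb E v = {a} \<Longrightarrow> graph_poly E = (Var v + Var a) * graph_poly (del E {v})"
    and "nb E v = {a, b} \<Longrightarrow> a \<noteq> b \<Longrightarrow>
      graph_poly E = (Var v + Var a) * (Var v + Var b) * graph_poly (del E {v})"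
  using graph_poly_del[OF assms, of v] by simp_all

definition counterexample :: "'a set \<Rightarrow> ('a \<Rightarrow> 'a \<Rightarrow> bool) \<Rightarrow> 'a \<Rightarrow> 'a \<Rightarrow> 'a \<Rightarrow> bool" where
  "counterexample V E x y z \<longleftrightarrow> simple_graph V E \<and> K4_minor_free V E \<and> x \<in> V \<and> y \<in> V \<and> z \<in> V
     \<and> feasible_triple V E x y z \<and> Var x * Var y * Var z * graph_poly E \<in> cubes"

text \<open>Only the number of vertices counts: a smaller graph may contain new edges, and its
  triple is arbitrary.\<close>

definition minimal_counterexample :: "'a set \<Rightarrow> ('a \<Rightarrow> 'a \<Rightarrow> bool) \<Rightarrow> 'a \<Rightarrow> 'a \<Rightarrow> 'a \<Rightarrow> bool" where
  "minimal_counterexample V E x y z \<longleftrightarrow> counterexample V E x y z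
     \<and> (\<forall>(W :: 'a set) F p q r. card W < card V \<longrightarrow> \<not> counterexample W F p q r)"

lemma minimal_counterexampleD:
  assumes "minimal_counterexample V E x y z"
  shows "simple_graph V E" "K4_minor_free V E" "x \<in> V" "y \<in> V" "z \<in> V" "feasible_triple V E x y z"
    "Var x * Var y * Var z * graph_poly E \<in> cubes"
  using assms unfolding minimal_counterexample_def counterexample_def by simp_all

lemma minimal_counterexample_swap:
  assumes "minimal_counterexample V E x y z"
  shows "minimal_counterexample V E y x z" "minimal_counterexample V E x z y"
proof -
  note M = minimal_counterexampleD[OF assms]
  have "counterexample V E y x z" "counterexample V E x z y"
    using M feasible_triple_swap[OF M(1,6)] unfolding counterexample_def by (simp_all add: ac_simps)
  then show "minimal_counterexample V E y x z" "minimal_counterexample V E x z y"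
    using assms unfolding minimal_counterexample_def by simp_all
qed

lemma smaller_graph:
  fixes V W :: "'a set"
  assumes "minimal_counterexample V E x y z" "card W < card V" "simple_graph W F" "K4_minor_free W F"
    "p \<in> W" "q \<in> W" "r \<in> W" "feasible_triple W F p q r"
  shows "Var p * Var q * Var r * graph_poly F \<notin> cubes"
  using assms unfolding minimal_counterexample_def counterexample_def by blast

text \<open>A vertex r that makes p, q, r feasible settles the claim, as the ideal is closed under
  multiplication by x_r. If no chain joins p and q, then r = p will do; otherwise any r not chained
  to q. If all vertices are chained to q, they share one colour, so there are no edges, p = q, and
  x_p^2 is not in the ideal.\<close>

lemma smaller_graph_pair:
  fixes V W :: "'a set"
  assumes "minimal_counterexample V E x y z" "card W < card V" "simple_graph W F" "K4_minor_free W F"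
    "p \<in> W" "q \<in> W"
  shows "Var p * Var q * graph_poly F \<notin> cubes"
proof
  assume pq: "Var p * Var q * graph_poly F \<in> cubes"
  obtain c where c: "proper_3_coloring W F c" using ex_proper_3_coloring[OF assms(3,4)] by blast
  have no: "\<not> feasible_triple W F p q r" if "r \<in> W" for r
  proof
    assume "feasible_triple W F p q r"
    then have "Var p * Var q * Var r * graph_poly F \<notin> cubes"
      using smaller_graph[OF assms(1-6) that] by blast
    moreover have "Var p * Var q * Var r * graph_poly F = Var r * (Var p * Var q * graph_poly F)"
      by (simp add: ac_simps)
    ultimately show False using cubes_mult[OF pq] by simp
  qed
  have pq': "(diamond F)\<^sup>*\<^sup>* p q"
  proof (rule ccontr)
    assume "\<not> ?thesis"
    with c have "feasible_triple W F p q p"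
      unfolding feasible_triple_def by (intro conjI exI[of _ c]) simp_all
    then show False using no[OF assms(5)] by simp
  qed
  have all: "(diamond F)\<^sup>*\<^sup>* q r" if "r \<in> W" for r
  proof (rule ccontr)
    assume "\<not> ?thesis"
    with c diamonds_same_color[OF assms(3) c pq'] have "feasible_triple W F p q r"
      unfolding feasible_triple_def by (intro conjI exI[of _ c]) simp_all
    then show False using no[OF that] by simp
  qed
  have noedge: "\<not> F u v" for u v
  proof
    assume uv: "F u v"
    have "c q = c u" "c q = c v"
      by (rule diamonds_same_color[OF assms(3) c all], rule simple_graphD(2,3)[OF assms(3) uv])+
    then show False using coloring_neq[OF c uv] by simp
  qed
  have "p = q" using pq' by (cases rule: converse_rtranclpE) (simp_all add: diamond_def noedge)
  moreover have "graph_poly F = 1" by (rule graph_poly_no_edges[OF noedge])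
  ultimately have sq: "Var p ^ 2 * 1 \<in> cubes" using pq by (simp add: power2_eq_square)
  have "Var p ^ 2 * 1 = Var p ^ 3 * 0 + Var p ^ 2 * 1 + Var p * 0 + 0" by simp
  from cubes_coeffs(3)[OF sq this var_free_0 var_free_0 var_free_1]
  show False by (simp add: cubes_def)
qed

text \<open>With d the degree of v, the coefficient of x_v^d is the same product formed in the graph
  without v. It can be compared because d < 3.\<close>

lemma minimal_degree_le_2:
  assumes "minimal_counterexample V E x y z" "v \<in> V" "card (nb E v) \<le> 2"
  shows "v = x \<or> v = y \<or> v = z"
proof (rule ccontr)
  assume "\<not> ?thesis"
  then have v: "x \<noteq> v" "y \<noteq> v" "z \<noteq> v" by auto
  note M = minimal_counterexampleD[OF assms(1)]
  let ?P = "graph_poly (del E {v})" and ?Q = "Var x * Var y * Var z"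
  have fP: "var_free v ?P" by (rule var_free_graph_poly_del[OF M(1)]) simp
  note fr = v fP var_free_intros
  have "card (V - {v}) < card V" using assms(2) simple_graphD(1)[OF M(1)] by (intro psubset_card_mono) auto
  then have "?Q * ?P \<notin> cubes"
    using v M by (intro smaller_graph[OF assms(1) _ simple_del[OF M(1)] K4_minor_free_del[OF M(2)]]
        feasible_triple_del) simp_all
  moreover have "?Q * ?P \<in> cubes"
    using finite_nb[OF M(1)] assms(3)
  proof (cases rule: card_le_2_cases)
    case 1
    then show ?thesis using M(7) graph_poly_degree(1)[OF M(1)] by simp
  next
    case (2 a)
    then have a: "a \<noteq> v" using simple_graphD(5)[OF M(1)] by (auto simp: nb_def)
    have "?Q * graph_poly E = Var v ^ 3 * 0 + Var v ^ 2 * 0 + Var v * (?Q * ?P) + Var a * (?Q * ?P)"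
      unfolding graph_poly_degree(2)[OF M(1) 2] by (simp add: algebra_simps)
    from cubes_coeffs(2)[OF M(7) this] show ?thesis using a by (simp add: fr)
  next
    case (3 a b)
    then have a: "a \<noteq> v" "b \<noteq> v" using simple_graphD(5)[OF M(1), of v] nb_iff[of v E v] by auto
    have "?Q * graph_poly E = Var v ^ 3 * 0 + Var v ^ 2 * (?Q * ?P) + Var v * ((Var a + Var b) * (?Q * ?P))
        + Var a * Var b * (?Q * ?P)"
      unfolding graph_poly_degree(3)[OF M(1) 3] by (simp add: algebra_simps power2_eq_square)
    from cubes_coeffs(3)[OF M(7) this] show ?thesis using a by (simp add: fr)
  qed
  ultimately show False by blast
qed

lemma card_del: "simple_graph V E \<Longrightarrow> v \<in> V \<Longrightarrow> card (V - {v}) < card V"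
  using simple_graphD(1)[of V E] by (intro psubset_card_mono) auto

text \<open>As x_x^2 is already a factor, the coefficient of x_x^2 is obtained by choosing the other
  endpoint of every edge at x: it is the product of the neighbours of x, times x_z and the
  polynomial of the remaining graph.\<close>

lemma minimal_distinct:
  assumes M: "minimal_counterexample V E x x z"
  shows False
proof -
  note D = minimal_counterexampleD[OF M]
  note S = simple_graphD[OF D(1)]
  have zx: "z \<noteq> x" using D(6) unfolding feasible_triple_def by auto
  note small = card_del[OF D(1,3)]
  note D1 = simple_del[OF D(1), of "{x}"] K4_minor_free_del[OF D(2), of "{x}"]
  have zW: "z \<in> V - {x}" using D(5) zx by simp
  \<comment> \<open>Two non-adjacent vertices of degree at most 2 both belong to {x, z}, so one of
    them is \<open>x\<close>.\<close>
  have deg: "card (nb E x) \<le> 2"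
  proof -
    consider u v where "u \<in> V" "v \<in> V" "u \<noteq> v" "\<not> E u v" "card (nb E u) \<le> 2" "card (nb E v) \<le> 2"
      | "card V \<le> 3"
      using two_vertices_degree_le_2[OF D(1,2)] D(3) by blast
    then show ?thesis
    proof cases
      case 1
      then have "u = x \<or> v = x"
        using minimal_degree_le_2[OF M, of u] minimal_degree_le_2[OF M, of v] by blast
      with 1 show ?thesis by blast
    next
      case 2
      have "nb E x \<subseteq> V - {x}" using S(3,5) by (auto simp: nb_def)
      then have "card (nb E x) \<le> card (V - {x})" using S(1) by (intro card_mono) auto
      also have "\<dots> < card V" by (rule small)
      finally show ?thesis using 2 by simp
    qed
  qed
  let ?P = "graph_poly (del E {x})"
  have fP: "var_free x ?P" by (rule var_free_graph_poly_del[OF D(1)]) simp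
  note fr = zx fP var_free_intros
  from finite_nb[OF D(1)] deg show ?thesis
  proof (cases rule: card_le_2_cases)
    case 1
    have "Var x * Var x * Var z * graph_poly E = Var x ^ 3 * 0 + Var x ^ 2 * (Var z * ?P) + Var x * 0 + 0"
      unfolding graph_poly_degree(1)[OF D(1) 1] by (simp add: algebra_simps power2_eq_square)
    from cubes_coeffs(3)[OF D(7) this] have "Var z * ?P \<in> cubes" by (simp add: fr)
    then have "Var z * (Var z * ?P) \<in> cubes" by (rule cubes_mult)
    with smaller_graph_pair[OF M small D1 zW zW] show ?thesis by (simp add: ac_simps)
  next
    case (2 a)
    then have "E x a" by (auto simp: nb_def)
    then have a: "a \<noteq> x" "a \<in> V - {x}" using S(3,5) by blast+
    have "Var x * Var x * Var z * graph_poly E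
      = Var x ^ 3 * (Var z * ?P) + Var x ^ 2 * (Var a * Var z * ?P) + Var x * 0 + 0"
      unfolding graph_poly_degree(2)[OF D(1) 2] by (simp add: algebra_simps power2_eq_square power3_eq_cube)
    from cubes_coeffs(3)[OF D(7) this] have "Var a * Var z * ?P \<in> cubes" using a by (simp add: fr)
    with smaller_graph_pair[OF M small D1 a(2) zW] show ?thesis by blast
  next
    case (3 a b)
    have xE: "E x u \<longleftrightarrow> u = a \<or> u = b" for u using 3(1) nb_iff[of u E x] by auto
    have aW: "a \<noteq> x" "a \<in> V - {x}" and bW: "b \<noteq> x" "b \<in> V - {x}"
      using xE S(3)[of x a] S(3)[of x b] S(5)[of x] by auto
    have "Var x * Var x * Var z * graph_poly E = Var x ^ 3 * ((Var x + Var a + Var b) * (Var z * ?P))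
        + Var x ^ 2 * (Var a * Var b * Var z * ?P) + Var x * 0 + 0"
      unfolding graph_poly_degree(3)[OF D(1) 3] by (simp add: algebra_simps power2_eq_square power3_eq_cube)
    then have "Var x * Var x * Var z * graph_poly E = Var x ^ 3 * (Var z * ?P * Var x + (Var a + Var b) * (Var z * ?P))
        + Var x ^ 2 * (Var a * Var b * Var z * ?P) + Var x * 0 + 0"
      by (simp add: algebra_simps)
    from cubes_coeffs(3)[OF D(7) this] have N: "Var a * Var b * Var z * ?P \<in> cubes"
      using aW bW by (simp add: fr)
    show ?thesis
    proof (cases "E a b")
      case nab: False
      let ?F = "add_edge (del E {x}) a b"
      have ab: "E x a" "E x b" using xE by blast+
      note F = K4_minor_free_fill[OF D(1,2) ab 3(2)]
      obtain c where c: "proper_3_coloring (V - {x}) ?F c" using ex_proper_3_coloring[OF F] by blast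
      have "c a \<noteq> c b" using coloring_neq[OF c] by (simp add: add_edge_def)
      \<comment> \<open>One of \<open>a\<close>, \<open>b\<close> differs in colour from
        \<open>z\<close>. Doubling it gives a feasible triple whose product is a multiple of its
        cube plus a multiple of \<open>N\<close>.\<close>
      then obtain s t where st: "s = a \<and> t = b \<or> s = b \<and> t = a" and cz: "c z \<noteq> c s" by metis
      have P: "graph_poly ?F = (Var s + Var t) * ?P"
        using graph_poly_add_edge[OF D1(1), of a b] nab 3(2) st by (auto simp: del_def add.commute)
      have "feasible_triple (V - {x}) ?F s s z"
        using cz by (intro feasible_triple_of_coloring[OF F(1) c]) auto
      then have "Var s * Var s * Var z * graph_poly ?F \<notin> cubes"
        using smaller_graph[OF M small F] aW bW zW st by blast
      moreover have "Var s * Var s * Var z * graph_poly ?F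
          = Var z * ?P * Var s ^ 3 + Var s * (Var a * Var b * Var z * ?P)"
        unfolding P using st by (auto simp: algebra_simps power3_eq_cube)
      moreover have "Var z * ?P * Var s ^ 3 + Var s * (Var a * Var b * Var z * ?P) \<in> cubes"
        by (intro cubes_add cubes_mult Var_cube N)
      ultimately show ?thesis by simp
    next
      case Eab: True
      obtain c where c: "proper_3_coloring (V - {x}) (del E {x}) c" using ex_proper_3_coloring[OF D1] by blast
      have "del E {x} a b" using Eab aW bW by (simp add: del_def)
      then have cab: "c a \<noteq> c b" by (rule coloring_neq[OF c])
      \<comment> \<open>If \<open>z\<close> were \<open>a\<close> or \<open>b\<close>, the triple
        \<open>a\<close>, \<open>b\<close>, \<open>z\<close> would have exactly two colours and be
        feasible, against \<open>N\<close>.\<close>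
      have zab: "z \<noteq> a" "z \<noteq> b"
      proof -
        have "\<not> feasible_triple (V - {x}) (del E {x}) a b z"
          using smaller_graph[OF M small D1 aW(2) bW(2) zW] N by blast
        then show "z \<noteq> a" "z \<noteq> b"
          using feasible_triple_of_coloring[OF D1(1) c, of a b z] cab by auto
      qed
      have nocommon: "u = x" if u: "E a u" "E b u" for u
      proof (rule ccontr)
        assume "u \<noteq> x"
        then have uW: "u \<in> V - {x}" using S(3) u by blast
        have t: "del E {x} a b" "del E {x} b u" "del E {x} a u"
          using Eab u aW bW \<open>u \<noteq> x\<close> by (simp_all add: del_def)
        have "diamond E x u" unfolding diamond_def using xE Eab u by blast
        moreover have "\<not> (diamond E)\<^sup>*\<^sup>* x z" using D(6) unfolding feasible_triple_def by blast
        ultimately have "\<not> (diamond E)\<^sup>*\<^sup>* u z" by (meson converse_rtranclp_into_rtranclp)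
        then have "\<not> (diamond (del E {x}))\<^sup>*\<^sup>* u z" using diamonds_del[of E "{x}" u z] by blast
        then have "feasible_triple (V - {x}) (del E {x}) u u z"
          unfolding feasible_triple_def using c by blast
        then have "Var u * Var u * Var z * ?P \<notin> cubes" by (rule smaller_graph[OF M small D1 uW uW zW])
        \<comment> \<open>Modulo the two triangle relations, x_u^2 may be replaced by x_a
          x_b.\<close>
        moreover have "Var u * Var u * Var z * ?P = Var z * Var u * ((Var a + Var b + Var u) * ?P)
            + Var z * ((Var a * Var b + Var b * Var u + Var u * Var a) * ?P) + Var a * Var b * Var z * ?P"
          by (simp add: algebra_simps)
        moreover have "\<dots> \<in> cubes"
          by (intro cubes_add cubes_mult graph_poly_triangle[OF D1(1) t] N)
        ultimately show False by simp
      qed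
      \<comment> \<open>Vertices of small degree in the graph without \<open>x\<close> are among
        \<open>a\<close>, \<open>b\<close>, \<open>z\<close>, so of two such vertices one is
        \<open>a\<close> or \<open>b\<close>. If the graph without \<open>x\<close> were complete,
        \<open>z\<close> would be a forbidden common neighbour of \<open>a\<close> and
        \<open>b\<close>.\<close>
      have "\<exists>s t. (s = a \<and> t = b \<or> s = b \<and> t = a) \<and> card (nb (del E {x}) s) \<le> 2"
      proof -
        consider u v where "u \<in> V - {x}" "v \<in> V - {x}" "u \<noteq> v" "\<not> del E {x} u v"
            "card (nb (del E {x}) u) \<le> 2" "card (nb (del E {x}) v) \<le> 2"
          | "\<forall>u\<in>V - {x}. \<forall>v\<in>V - {x}. u \<noteq> v \<longrightarrow> del E {x} u v"
          using two_vertices_degree_le_2[OF D1] zW by blast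
        then show ?thesis
        proof cases
          case 1
          have w: "w = a \<or> w = b \<or> w = z" if "w \<in> V - {x}" "card (nb (del E {x}) w) \<le> 2" for w
          proof (rule ccontr)
            assume no: "\<not> ?thesis"
            then have "\<not> E x w" using xE by blast
            then have "nb (del E {x}) w = nb E w" using that(1) D(1) by (intro nb_del_nonadjacent) auto
            then show False using minimal_degree_le_2[OF M, of w] that no by auto
          qed
          have "u = a \<or> u = b \<or> v = a \<or> v = b"
            using w[OF 1(1,5)] w[OF 1(2,6)] 1(3) by auto
          then obtain s where s: "s = a \<or> s = b" "card (nb (del E {x}) s) \<le> 2" using 1(5,6) by blast
          from s(1) show ?thesis
          proof
            assume "s = a" with s(2) show ?thesis by (intro exI[of _ a] exI[of _ b]) simp
          next
            assume "s = b" with s(2) show ?thesis by (intro exI[of _ b] exI[of _ a]) simp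
          qed
        next
          case 2
          have "del E {x} a z" "del E {x} b z"
            using 2[rule_format, OF aW(2) zW] 2[rule_format, OF bW(2) zW] zab by simp_all
          then show ?thesis using nocommon[of z] zx by (simp add: del_def)
        qed
      qed
      then obtain s t where st: "s = a \<and> t = b \<or> s = b \<and> t = a" and ds: "card (nb (del E {x}) s) \<le> 2" by blast
      have sW: "s \<in> V - {x}" and tW: "t \<in> V - {x}" and stE: "E s t" "s \<noteq> t" "z \<noteq> s" "E x s"
        using st aW bW Eab S(4)[OF Eab] 3(2) zab xE by auto
      have nbs: "nb E s = insert x (nb (del E {x}) s)"
        using S(4)[OF stE(4)] sW by (auto simp: nb_def del_def)
      have "\<not> card (nb E s) \<le> 2" using minimal_degree_le_2[OF M, of s] sW stE by blast
      moreover have "x \<notin> nb (del E {x}) s" by (simp add: nb_def del_def)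
      ultimately have "card (nb (del E {x}) s) = 2"
        using ds finite_nb[OF D1(1), of s] unfolding nbs by simp
      moreover have tn: "t \<in> nb (del E {x}) s" using stE(1) sW tW by (simp add: nb_def del_def)
      ultimately obtain u where nb': "nb (del E {x}) s = {t, u}" and tu: "t \<noteq> u"
        by (auto simp: card_2_iff doubleton_eq_iff)
      have su: "del E {x} s u" "del E {x} s t" using nb' by (auto simp: nb_def)
      then have "\<not> E t u" using nocommon[of u] st by (auto simp: del_def)
      let ?D = "del (del E {x}) {s}" and ?W = "V - {x} - {s}"
      let ?F = "add_edge ?D t u" and ?R = "graph_poly (del (del E {x}) {s})"
      note D2 = simple_del[OF D1(1), of "{s}"]
      note F = K4_minor_free_fill[OF D1 su(2) su(1) tu]
      have us: "u \<noteq> s" "u \<in> ?W" using su simple_graphD(3,5)[OF D1(1)] by blast+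
      have tW': "t \<in> ?W" and zW': "z \<in> ?W" using tW zW stE by auto
      have fR: "var_free s ?R" by (rule var_free_graph_poly_del[OF D1(1)]) simp
      have smallW: "card ?W < card V" using card_del[OF D1(1) sW] small by linarith
      have PF: "graph_poly ?F = (Var t + Var u) * ?R"
        using \<open>\<not> E t u\<close> tu by (intro graph_poly_add_edge[OF D2]) (auto simp: del_def)
      \<comment> \<open>A second elimination, at \<open>s\<close>, where two coefficients are used:
        x_s^2 yields the factor x_t (x_t + x_u) and x_s the factor x_t^2 x_u. They allow either
        \<open>t\<close> or \<open>u\<close> to be doubled, whichever differs in colour from
        \<open>z\<close>.\<close>
      have "Var a * Var b * Var z * ?P = Var s * Var t * Var z * ?P" using st by (auto simp: ac_simps)
      also have "\<dots> = Var s ^ 3 * (Var t * Var z * ?R) + Var s ^ 2 * (Var t * (Var t + Var u) * Var z * ?R)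
          + Var s * (Var t * Var t * Var u * Var z * ?R) + 0"
        unfolding graph_poly_degree(3)[OF D1(1) nb' tu]
        by (simp add: algebra_simps power2_eq_square power3_eq_cube)
      finally have eq: "Var a * Var b * Var z * ?P = Var s ^ 3 * (Var t * Var z * ?R)
          + Var s ^ 2 * (Var t * (Var t + Var u) * Var z * ?R)
          + Var s * (Var t * Var t * Var u * Var z * ?R) + 0" .
      have A: "Var t * (Var t + Var u) * Var z * ?R \<in> cubes" "Var t * Var t * Var u * Var z * ?R \<in> cubes"
        using cubes_coeffs(2,3)[OF N eq] stE us fR by (simp_all add: var_free_intros)
      obtain k where k: "proper_3_coloring ?W ?F k" using ex_proper_3_coloring[OF F] by blast
      have ktu: "k t \<noteq> k u" using coloring_neq[OF k] by (simp add: add_edge_def)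
      show ?thesis
      proof (cases "k z = k t")
        case False
        then have "feasible_triple ?W ?F t t z" by (intro feasible_triple_of_coloring[OF F(1) k]) auto
        then have "Var t * Var t * Var z * graph_poly ?F \<notin> cubes"
          by (rule smaller_graph[OF M smallW F tW' tW' zW'])
        moreover have "Var t * Var t * Var z * graph_poly ?F
            = Var z * ?R * Var t ^ 3 + Var t * Var t * Var u * Var z * ?R"
          unfolding PF by (simp add: algebra_simps power3_eq_cube)
        moreover have "\<dots> \<in> cubes" by (intro cubes_add cubes_mult Var_cube A)
        ultimately show ?thesis by simp
      next
        case True
        with ktu have "feasible_triple ?W ?F u u z" by (intro feasible_triple_of_coloring[OF F(1) k]) auto
        then have "Var u * Var u * Var z * graph_poly ?F \<notin> cubes"
          by (rule smaller_graph[OF M smallW F us(2) us(2) zW'])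
        moreover have "Var u * Var u * Var z * graph_poly ?F = Var z * ?R * Var u ^ 3
            + Var u * (Var t * (Var t + Var u) * Var z * ?R) + Var t * Var t * Var u * Var z * ?R"
          unfolding PF by (simp add: algebra_simps power3_eq_cube)
        moreover have "\<dots> \<in> cubes" by (intro cubes_add cubes_mult Var_cube A)
        ultimately show ?thesis by simp
      qed
    qed
  qed
qed

section \<open>Vertices of degree at most 2 in a minimal counterexample\<close>

lemma minimal_leaf:
  assumes M: "minimal_counterexample V E x y z" and d: "card (nb E x) \<le> 2"
  shows "\<exists>a b. nb E x = {a, b} \<and> a \<noteq> b \<and> E a b \<and> (\<forall>u. E a u \<and> E b u \<longrightarrow> u = x)"
proof -
  note D = minimal_counterexampleD[OF M]
  note S = simple_graphD[OF D(1)]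
  have yx: "y \<noteq> x" "z \<noteq> x"
    using M minimal_distinct minimal_counterexample_swap by metis+
  note small = card_del[OF D(1,3)]
  note D1 = simple_del[OF D(1), of "{x}"] K4_minor_free_del[OF D(2), of "{x}"]
  have W: "y \<in> V - {x}" "z \<in> V - {x}" using D yx by simp_all
  let ?P = "graph_poly (del E {x})"
  have fP: "var_free x ?P" by (rule var_free_graph_poly_del[OF D(1)]) simp
  note fr = yx fP var_free_intros
  have pair: "Var y * Var z * ?P \<notin> cubes" by (rule smaller_graph_pair[OF M small D1 W])
  from finite_nb[OF D(1)] d show ?thesis
  proof (cases rule: card_le_2_cases)
    case 1
    have "Var x * Var y * Var z * graph_poly E
      = Var x ^ 3 * 0 + Var x ^ 2 * 0 + Var x * (Var y * Var z * ?P) + 0"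
      unfolding graph_poly_degree(1)[OF D(1) 1] by (simp add: algebra_simps)
    from cubes_coeffs(2)[OF D(7) this] have "Var y * Var z * ?P \<in> cubes" by (simp add: fr)
    with pair show ?thesis by blast
  next
    case (2 a)
    then have "E x a" by (auto simp: nb_def)
    then have a: "a \<noteq> x" using S(5) by blast
    have "Var x * Var y * Var z * graph_poly E
      = Var x ^ 3 * 0 + Var x ^ 2 * (Var y * Var z * ?P) + Var x * (Var a * Var y * Var z * ?P) + 0"
      unfolding graph_poly_degree(2)[OF D(1) 2] by (simp add: algebra_simps power2_eq_square)
    from cubes_coeffs(3)[OF D(7) this] have "Var y * Var z * ?P \<in> cubes" using a by (simp add: fr)
    with pair show ?thesis by blast
  next
    case (3 a b)
    have xE: "E x u \<longleftrightarrow> u = a \<or> u = b" for u using 3(1) nb_iff[of u E x] by auto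
    have ab: "E x a" "E x b" using xE by blast+
    have aW: "a \<noteq> x" "b \<noteq> x" using ab S(5) by blast+
    have "Var x * Var y * Var z * graph_poly E = Var x ^ 3 * (Var y * Var z * ?P)
        + Var x ^ 2 * ((Var a + Var b) * Var y * Var z * ?P) + Var x * (Var a * Var b * Var y * Var z * ?P) + 0"
      unfolding graph_poly_degree(3)[OF D(1) 3] by (simp add: algebra_simps power2_eq_square power3_eq_cube)
    from cubes_coeffs(3)[OF D(7) this] have N: "(Var a + Var b) * Var y * Var z * ?P \<in> cubes"
      using aW by (simp add: fr)
    \<comment> \<open>Once x_a + x_b is absorbed as a new edge, only the variables of
      \<open>y\<close> and \<open>z\<close> remain, and for a pair no feasibility has to be
      checked.\<close>
    have Eab: "E a b"
    proof (rule ccontr)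
      assume "\<not> E a b"
      let ?F = "add_edge (del E {x}) a b"
      have "graph_poly ?F = (Var a + Var b) * ?P"
        using \<open>\<not> E a b\<close> 3(2) by (intro graph_poly_add_edge[OF D1(1)]) (auto simp: del_def)
      then have "Var y * Var z * graph_poly ?F \<in> cubes" using N by (simp add: ac_simps)
      with smaller_graph_pair[OF M small K4_minor_free_fill[OF D(1,2) ab 3(2)] W] show False by blast
    qed
    have "u = x" if u: "E a u" "E b u" for u
    proof (rule ccontr)
      assume ux: "u \<noteq> x"
      have uW: "u \<in> V - {x}" using ux S(3) u by blast
      have t: "del E {x} a b" "del E {x} b u" "del E {x} a u"
        using Eab u aW ux by (simp_all add: del_def)
      have xu: "(diamond E)\<^sup>*\<^sup>* x u" unfolding diamond_def using xE Eab u by blast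
      \<comment> \<open>As the other end of a diamond, \<open>u\<close> has the colour of
        \<open>x\<close> in every colouring of the whole graph, and a chain starting at
        \<open>u\<close> extends to one starting at \<open>x\<close>. Here \<open>u\<close> may
        coincide with \<open>y\<close> or \<open>z\<close>.\<close>
      have "feasible_triple (V - {x}) (del E {x}) u y z"
      proof -
        have "\<not> ((diamond E)\<^sup>*\<^sup>* u y \<and> (diamond E)\<^sup>*\<^sup>* y z)"
          using D(6) rtranclp_trans[OF xu] unfolding feasible_triple_def by blast
        moreover obtain c where c: "proper_3_coloring V E c" "c x = c y \<or> c x = c z \<or> c y = c z"
          using D(6) unfolding feasible_triple_def by blast
        moreover have "c x = c u" by (rule diamonds_same_color[OF D(1) c(1) xu])
        ultimately show ?thesis
          unfolding feasible_triple_def using diamonds_del[of E "{x}"] coloring_del[OF c(1), of "{x}"] by metis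
      qed
      then have "Var u * Var y * Var z * ?P \<notin> cubes" by (rule smaller_graph[OF M small D1 uW W])
      moreover have "Var u * Var y * Var z * ?P
          = Var y * Var z * ((Var a + Var b + Var u) * ?P) + (Var a + Var b) * Var y * Var z * ?P"
        by (simp add: algebra_simps)
      moreover have "\<dots> \<in> cubes"
        by (intro cubes_add cubes_mult graph_poly_triangle[OF D1(1) t] N)
      ultimately show False by simp
    qed
    with 3 Eab show ?thesis by blast
  qed
qed

text \<open>Otherwise x, y and some b form a triangle in which x and y have no further neighbours,
  and eliminating both leaves the factor x_b^2. In the colouring supplied by feasibility x and y
  differ, so z shares the colour of one of them and differs from b; thus b, b, z is
  feasible.\<close>

lemma minimal_leaves_nonadjacent:
  assumes M: "minimal_counterexample V E x y z" and d: "card (nb E x) \<le> 2" "card (nb E y) \<le> 2"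
  shows "\<not> E x y"
proof
  assume xy: "E x y"
  note D = minimal_counterexampleD[OF M]
  note S = simple_graphD[OF D(1)]
  have dist: "y \<noteq> x" "z \<noteq> x" "z \<noteq> y"
    using M minimal_distinct minimal_counterexample_swap by metis+
  obtain b where nbx: "nb E x = {y, b}" and yb: "y \<noteq> b" "E y b"
  proof -
    obtain p q where pq: "nb E x = {p, q}" "p \<noteq> q" "E p q" using minimal_leaf[OF M d(1)] by blast
    have "y \<in> {p, q}" using xy pq(1) nb_iff[of y E x] by simp
    with pq S(4)[OF pq(3)] that[of q] that[of p] show ?thesis by (auto simp: insert_commute)
  qed
  have xb: "E x b" using nbx nb_iff[of b E x] by simp
  then have bx: "b \<noteq> x" using S(5) by blast
  have nby: "nb E y = {x, b}"
  proof -
    have "{x, b} \<subseteq> nb E y" using S(4)[OF xy] yb by (simp add: nb_def)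
    then have "{x, b} = nb E y" using d(2) bx by (intro card_seteq finite_nb[OF D(1)]) auto
    then show ?thesis ..
  qed
  note D1 = simple_del[OF D(1), of "{x}"] K4_minor_free_del[OF D(2), of "{x}"]
  note D2 = simple_del[OF D1(1), of "{y}"] K4_minor_free_del[OF D1(2), of "{y}"]
  let ?W = "V - {x} - {y}" and ?D = "del (del E {x}) {y}"
  let ?R = "graph_poly (del (del E {x}) {y})"
  have nb': "nb (del E {x}) y = {b}"
    using nby dist bx by (auto simp: nb_def del_def)
  have fR: "var_free y ?R" by (rule var_free_graph_poly_del[OF D1(1)]) simp
  have fx: "var_free x ?R"
    by (rule var_free_graph_poly[OF D2(1)]) (auto simp: nb_def del_def)
  have yW: "y \<in> V - {x}" using D dist by simp
  have small: "card ?W < card V" using card_del[OF D(1,3)] card_del[OF D1(1) yW] by linarith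
  have "Var x * Var y * Var z * graph_poly E = Var x ^ 3 * (Var y * Var z * ((Var y + Var b) * ?R))
      + Var x ^ 2 * ((Var y + Var b) * Var y * Var z * ((Var y + Var b) * ?R))
      + Var x * (Var y * Var b * Var y * Var z * ((Var y + Var b) * ?R)) + 0"
    unfolding graph_poly_degree(3)[OF D(1) nbx yb(1)] graph_poly_degree(2)[OF D1(1) nb']
    by (simp add: algebra_simps power2_eq_square power3_eq_cube)
  \<comment> \<open>Exponent 1 at \<open>x\<close>, followed by exponent 2 at \<open>y\<close>, is
    the choice that produces x_b^2.\<close>
  from cubes_coeffs(2)[OF D(7) this]
  have N: "Var y * Var b * Var y * Var z * ((Var y + Var b) * ?R) \<in> cubes"
    using dist bx fx by (simp add: var_free_intros)
  have "Var y * Var b * Var y * Var z * ((Var y + Var b) * ?R)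
      = Var y ^ 3 * (Var b * Var z * ?R) + Var y ^ 2 * (Var b * Var b * Var z * ?R) + Var y * 0 + 0"
    by (simp add: algebra_simps power2_eq_square power3_eq_cube)
  from cubes_coeffs(3)[OF N this] have N2: "Var b * Var b * Var z * ?R \<in> cubes"
    using dist yb fR by (simp add: var_free_intros)
  obtain k where k: "proper_3_coloring V E k" "k x = k y \<or> k x = k z \<or> k y = k z"
    using D(6) unfolding feasible_triple_def by blast
  have "k b \<noteq> k z"
    using k(2) coloring_neq[OF k(1) xy] coloring_neq[OF k(1) xb] coloring_neq[OF k(1) yb(2)] by auto
  then have "feasible_triple ?W ?D b b z"
    using coloring_del[OF coloring_del[OF k(1)]] by (intro feasible_triple_of_coloring[OF D2(1), of k]) auto
  moreover have "b \<in> ?W" "z \<in> ?W" using S(3)[OF xb] bx yb D dist by auto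
  ultimately show False using smaller_graph[OF M small D2] N2 by blast
qed

text \<open>The vertex x is the tip of a triangle on the edge tp, and q is the only other neighbour
  of t. Eliminating x and then t gives two relations at once; the first restricts the colours of q,
  y, z, and both together refute the triple p, y, z in the graph where x and t are replaced by the
  edge pq.\<close>

lemma minimal_no_ladder_step:
  assumes M: "minimal_counterexample V E x y z" and t: "t \<noteq> x" "t \<noteq> y" "t \<noteq> z"
    and nbt: "nb E t = {x, p, q}" "p \<noteq> q" and nbx: "nb E x = {t, p}" "t \<noteq> p" and pq: "\<not> E p q"
  shows False
proof -
  note D = minimal_counterexampleD[OF M]
  note S = simple_graphD[OF D(1)]
  have dist: "y \<noteq> x" "z \<noteq> x"
    using M minimal_distinct minimal_counterexample_swap by metis+
  have tE: "E t u \<longleftrightarrow> u = x \<or> u = p \<or> u = q" for u using nbt(1) nb_iff[of u E t] by auto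
  have xE: "E x u \<longleftrightarrow> u = t \<or> u = p" for u using nbx(1) nb_iff[of u E x] by auto
  have xp: "E x p" "E t p" "E t q" using xE tE by blast+
  have px: "p \<noteq> x" "p \<noteq> t" "q \<noteq> t" using xp S(5) by blast+
  have qx: "q \<noteq> x" using pq S(4)[OF xp(1)] by blast
  note D1 = simple_del[OF D(1), of "{x}"] K4_minor_free_del[OF D(2), of "{x}"]
  note D2 = simple_del[OF D1(1), of "{t}"] K4_minor_free_del[OF D1(2), of "{t}"]
  have nb': "nb (del E {x}) t = {p, q}"
    using nbt(1) t px qx by (auto simp: nb_def del_def)
  let ?W = "V - {x} - {t}" and ?D = "del (del E {x}) {t}"
  let ?R = "graph_poly (del (del E {x}) {t})" and ?F = "add_edge (del (del E {x}) {t}) p q"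
  have tp: "del E {x} t p" "del E {x} t q" using xp t px qx by (simp_all add: del_def)
  note F = K4_minor_free_fill[OF D1 tp nbt(2)]
  have fR: "var_free t ?R" by (rule var_free_graph_poly_del[OF D1(1)]) simp
  have fx: "var_free x ?R"
    by (rule var_free_graph_poly[OF D2(1)]) (auto simp: nb_def del_def)
  have tW: "t \<in> V - {x}" using S(2)[OF xp(2)] t by simp
  have small: "card ?W < card V" using card_del[OF D(1,3)] card_del[OF D1(1) tW] by linarith
  have W: "p \<in> ?W" "q \<in> ?W" "y \<in> ?W" "z \<in> ?W"
    using S(3)[OF xp(2)] S(3)[OF xp(3)] px qx D dist t by auto
  have "Var x * Var y * Var z * graph_poly E = Var x ^ 3 * (Var y * Var z * ((Var t + Var p) * (Var t + Var q) * ?R))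
      + Var x ^ 2 * ((Var t + Var p) * Var y * Var z * ((Var t + Var p) * (Var t + Var q) * ?R))
      + Var x * (Var t * Var p * Var y * Var z * ((Var t + Var p) * (Var t + Var q) * ?R)) + 0"
    unfolding graph_poly_degree(3)[OF D(1) nbx] graph_poly_degree(3)[OF D1(1) nb' nbt(2)]
    by (simp add: algebra_simps power2_eq_square power3_eq_cube)
  from cubes_coeffs(3)[OF D(7) this]
  have N: "(Var t + Var p) * Var y * Var z * ((Var t + Var p) * (Var t + Var q) * ?R) \<in> cubes"
    using dist t px qx fx by (simp add: var_free_intros)
  \<comment> \<open>Since (x_t + x_p)^2 = x_t^2 + x_p^2, the coefficients of x_t^2 and x_t have only
    the single terms with x_q and x_p^2.\<close>
  have "(Var t + Var p) * Var y * Var z * ((Var t + Var p) * (Var t + Var q) * ?R)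
      = Var t ^ 3 * (Var y * Var z * ?R) + Var t ^ 2 * (Var q * Var y * Var z * ?R)
        + Var t * (Var p * Var p * Var y * Var z * ?R) + Var p * Var p * Var q * Var y * Var z * ?R"
    by (simp add: algebra_simps power2_eq_square power3_eq_cube)
  note A = cubes_coeffs(2,3)[OF N this]
  have A: "Var q * Var y * Var z * ?R \<in> cubes" "Var p * Var p * Var y * Var z * ?R \<in> cubes"
    using A t px qx fR by (simp_all add: var_free_intros)
  obtain k where k: "proper_3_coloring ?W ?F k" using ex_proper_3_coloring[OF F] by blast
  have kpq: "k p \<noteq> k q" using coloring_neq[OF k] by (simp add: add_edge_def)
  have k': "proper_3_coloring ?W ?D k" by (rule coloring_mono[OF k]) (auto simp: add_edge_def)
  have "\<not> feasible_triple ?W ?D q y z" using smaller_graph[OF M small D2 W(2-4)] A(1) by blast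
  then have "\<not> (\<not> (k q = k y \<and> k y = k z) \<and> (k q = k y \<or> k q = k z \<or> k y = k z))"
    using feasible_triple_of_coloring[OF D2(1) k', of q y z] by blast
  \<comment> \<open>By the previous line \<open>q\<close>, \<open>y\<close>, \<open>z\<close> have
    one colour or three. As \<open>p\<close> and \<open>q\<close> differ, in both cases exactly two
    colours occur on \<open>p\<close>, \<open>y\<close>, \<open>z\<close>.\<close>
  then have "\<not> (k p = k y \<and> k y = k z)" "k p = k y \<or> k p = k z \<or> k y = k z"
    using kpq coloring_values[OF k W(1)] coloring_values[OF k W(2)]
      coloring_values[OF k W(3)] coloring_values[OF k W(4)] by (elim disjE; simp)+
  then have "feasible_triple ?W ?F p y z" by (rule feasible_triple_of_coloring[OF F(1) k])
  then have "Var p * Var y * Var z * graph_poly ?F \<notin> cubes" by (rule smaller_graph[OF M small F W(1,3,4)])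
  moreover have "graph_poly ?F = (Var p + Var q) * ?R"
    using pq nbt(2) by (intro graph_poly_add_edge[OF D2(1)]) (auto simp: del_def)
  then have "Var p * Var y * Var z * graph_poly ?F
      = Var p * Var p * Var y * Var z * ?R + Var p * (Var q * Var y * Var z * ?R)"
    by (simp add: algebra_simps)
  moreover have "\<dots> \<in> cubes" by (intro cubes_add cubes_mult A)
  ultimately show False by simp
qed

lemma no_minimal_counterexample:
  "\<not> minimal_counterexample V E x y z"
proof
  assume M: "minimal_counterexample V E x y z"
  note D = minimal_counterexampleD[OF M]
  note S = simple_graphD[OF D(1)]
  note finnb = finite_nb[OF D(1)]
  note sw = minimal_counterexample_swap
  have dist: "x \<noteq> y" "x \<noteq> z" "y \<noteq> z"
    using M minimal_distinct sw by metis+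
  define X where "X = {x, y, z}"
  have cardX: "card X = 3" "finite X" using dist by (simp_all add: X_def)
  have lead: "\<exists>p q. minimal_counterexample V E l p q \<and> X = {l, p, q}" if "l \<in> X" for l
  proof -
    from that consider "l = x" | "l = y" | "l = z" by (auto simp: X_def)
    then show ?thesis
    proof cases
      case 1 with M show ?thesis by (intro exI[of _ y] exI[of _ z]) (simp add: X_def)
    next
      case 2 with sw(1)[OF M] show ?thesis
        by (intro exI[of _ x] exI[of _ z]) (simp add: X_def insert_commute)
    next
      case 3 with sw(1)[OF sw(2)[OF M]] show ?thesis
        by (intro exI[of _ x] exI[of _ y]) (simp add: X_def insert_commute)
    qed
  qed
  define L where "L = {v \<in> V. card (nb E v) \<le> 2}"
  have LX: "L \<subseteq> X"
  proof
    fix v assume "v \<in> L"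
    then show "v \<in> X" using minimal_degree_le_2[OF M, of v] by (simp add: L_def X_def)
  qed
  have leaf: "\<exists>a b. nb E l = {a, b} \<and> a \<noteq> b \<and> E a b \<and> (\<forall>u. E a u \<and> E b u \<longrightarrow> u = l)" if lL: "l \<in> L" for l
  proof -
    obtain p q where "minimal_counterexample V E l p q" using lead[of l] lL LX by blast
    then show ?thesis by (rule minimal_leaf) (use lL in \<open>simp add: L_def\<close>)
  qed
  have nonadj: "\<not> E l m" if lm: "l \<in> L" "m \<in> L" for l m
  proof (cases "l = m")
    case True then show ?thesis using S(5) by simp
  next
    case False
    obtain p q where pq: "minimal_counterexample V E l p q" "X = {l, p, q}" using lead[of l] lm LX by blast
    have "m \<in> {l, p, q}" using lm(2) LX pq(2) by blast
    with False have "m = p \<or> m = q" by blast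
    then obtain r where "minimal_counterexample V E l m r" using pq(1) sw(2)[OF pq(1)] by blast
    then show ?thesis by (rule minimal_leaves_nonadjacent) (use lm in \<open>simp_all add: L_def\<close>)
  qed
  have big: "3 \<le> card (nb E v)" if "v \<in> V" "v \<notin> L" for v using that by (simp add: L_def)
  let ?D = "del E L"
  note D0 = simple_del[OF D(1), of L] K4_minor_free_del[OF D(2), of L]
  have two: "\<exists>l m. l \<in> L \<and> m \<in> L \<and> l \<noteq> m"
  proof -
    consider u v where "u \<in> V" "v \<in> V" "u \<noteq> v" "card (nb E u) \<le> 2" "card (nb E v) \<le> 2"
      | "card V \<le> 3" "\<forall>u\<in>V. \<forall>v\<in>V. u \<noteq> v \<longrightarrow> E u v"
      using two_vertices_degree_le_2[OF D(1,2)] D(3) by blast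
    then show ?thesis
    proof cases
      case 1 then show ?thesis by (auto simp: L_def)
    next
      case 2
      have "v \<in> L" if "v \<in> V" for v
      proof -
        have "nb E v \<subseteq> V - {v}" using S(3,5) by (auto simp: nb_def)
        then have "card (nb E v) \<le> card (V - {v})" using S(1) by (intro card_mono) auto
        also have "\<dots> < card V" by (rule card_del[OF D(1) that])
        finally show ?thesis using 2 that by (simp add: L_def)
      qed
      then show ?thesis using D dist by blast
    qed
  qed
  obtain l m where lm: "l \<in> L" "m \<in> L" "l \<noteq> m" using two by blast
  obtain a b where l: "nb E l = {a, b}" "a \<noteq> b" "E a b" "\<And>u. E a u \<Longrightarrow> E b u \<Longrightarrow> u = l"
    using leaf[OF lm(1)] by blast
  have inW: "u \<in> V - L" if "E k u" "k \<in> L" for k u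
    using nonadj that S(3) by blast
  have la: "E l a" "E l b" using l(1) nb_iff[of a E l] nb_iff[of b E l] by simp_all
  consider t1 t2 where "t1 \<in> V - L" "t2 \<in> V - L" "t1 \<noteq> t2" "\<not> ?D t1 t2"
      "card (nb ?D t1) \<le> 2" "card (nb ?D t2) \<le> 2"
    | "\<forall>u\<in>V - L. \<forall>v\<in>V - L. u \<noteq> v \<longrightarrow> ?D u v"
    using two_vertices_degree_le_2[OF D0] inW[OF la(1) lm(1)] by blast
  then show False
  proof cases
    case 2
    \<comment> \<open>A neighbour of \<open>m\<close> other than \<open>a\<close>, \<open>b\<close>
      would lie in the complete rest and be a common neighbour of \<open>a\<close> and
      \<open>b\<close> besides \<open>l\<close>. So \<open>m\<close> is attached to \<open>a\<close>
      and \<open>b\<close>, which makes \<open>m\<close> itself such a neighbour.\<close>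
    then have cl: "E u v" if "u \<in> V - L" "v \<in> V - L" "u \<noteq> v" for u v
      using that by (auto simp: del_def)
    obtain c d where m: "nb E m = {c, d}" "c \<noteq> d" using leaf[OF lm(2)] by blast
    have mE: "E m u \<longleftrightarrow> u = c \<or> u = d" for u using m(1) nb_iff[of u E m] by auto
    have abW: "a \<in> V - L" "b \<in> V - L" using inW la lm(1) by blast+
    have "u = a \<or> u = b" if "E m u" for u
    proof (rule ccontr)
      assume no: "\<not> ?thesis"
      have "u \<in> V - L" using inW[OF that lm(2)] .
      then have "E a u" "E b u" using cl abW no by blast+
      then have "u = l" by (rule l(4))
      then show False using \<open>u \<in> V - L\<close> lm(1) by simp
    qed
    from this[of c] this[of d] m(2) mE have "{c, d} = {a, b}" by auto
    then have "E m a" "E m b" using mE[of a] mE[of b] by (auto simp: doubleton_eq_iff)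
    then have "E a m" "E b m" using S(4)[of m a] S(4)[of m b] by simp_all
    then show False using l(4) lm(3) by blast
  next
    case 1
    have tL: "t1 \<notin> L" "t2 \<notin> L" "t1 \<in> V" "t2 \<in> V" using 1 by blast+
    then have nt: "\<not> E t1 t2" using 1(4) by (simp add: del_def)
    define N where "N t = nb E t \<inter> L" for t
    have finN: "finite (N t)" for t using finnb by (simp add: N_def)
    have cN: "card (nb E t) = card (N t) + card (nb ?D t)" if "t \<notin> L" for t
    proof -
      have "nb E t = N t \<union> nb ?D t" using that by (auto simp: N_def nb_def del_def)
      moreover have "N t \<inter> nb ?D t = {}" by (auto simp: N_def nb_def del_def)
      ultimately show ?thesis using finN finite_nb[OF D0(1)] card_Un_disjoint by metis
    qed
    have N1: "1 \<le> card (N t1)" "1 \<le> card (N t2)"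
      using cN[OF tL(1)] cN[OF tL(2)] big[OF tL(3,1)] big[OF tL(4,2)] 1(5,6) by linarith+
    \<comment> \<open>The two neighbours of a vertex in \<open>L\<close> are adjacent, whereas
      \<open>t1\<close> and \<open>t2\<close> are not.\<close>
    have disj: "N t1 \<inter> N t2 = {}"
    proof (rule ccontr)
      assume "N t1 \<inter> N t2 \<noteq> {}"
      then obtain k where k: "k \<in> L" "E t1 k" "E t2 k" by (auto simp: N_def nb_def)
      then have kt: "E k t1" "E k t2" using S(4) by blast+
      obtain p q where p: "nb E k = {p, q}" "E p q" using leaf[OF k(1)] by blast
      then have "t1 \<in> {p, q}" "t2 \<in> {p, q}" using kt nb_iff[of t1 E k] nb_iff[of t2 E k] by simp_all
      then show False using 1(3) nt p(2) S(4)[OF p(2)] by blast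
    qed
    let ?T = "{t1, t2} \<inter> X"
    \<comment> \<open>Three disjoint parts of \<open>X\<close>, which has three elements. As
      \<open>t1\<close> and \<open>t2\<close> each have a neighbour in \<open>L\<close>, one of them
      lies outside \<open>X\<close> and has exactly one.\<close>
    have "card (N t1) + card (N t2) + card ?T \<le> 3"
    proof -
      have "card (N t1 \<union> N t2 \<union> ?T) = card (N t1 \<union> N t2) + card ?T"
        using finN tL by (intro card_Un_disjoint) (auto simp: N_def)
      moreover have "card (N t1 \<union> N t2) = card (N t1) + card (N t2)"
        using finN disj by (intro card_Un_disjoint) auto
      moreover have "card (N t1 \<union> N t2 \<union> ?T) \<le> card X"
        using LX cardX(2) by (intro card_mono) (auto simp: N_def)
      ultimately show ?thesis using cardX(1) by linarith
    qed
    moreover have "card ?T = (if t1 \<in> X then 1 else 0) + (if t2 \<in> X then 1 else 0)"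
      using 1(3) by (simp add: Int_insert_left)
    ultimately have "t1 \<notin> X \<and> card (N t1) = 1 \<or> t2 \<notin> X \<and> card (N t2) = 1"
      using N1 by (auto split: if_splits)
    then obtain t where t: "t \<notin> L" "t \<in> V" "t \<notin> X" "card (N t) = 1" "card (nb ?D t) \<le> 2"
      using tL 1(5,6) by blast
    obtain k where k: "N t = {k}" using t(4) by (meson card_1_singletonE)
    then have tk: "k \<in> L" "E t k" by (auto simp: N_def nb_def)
    have nbt: "nb E t = insert k (nb ?D t)"
      using k t(1) by (auto simp: N_def nb_def del_def)
    have "card (nb ?D t) = 2" using cN[OF t(1)] big[OF t(2,1)] t(4,5) by linarith
    obtain p where p: "nb E k = {t, p}" "t \<noteq> p" "E t p" "\<And>u. E t u \<Longrightarrow> E p u \<Longrightarrow> u = k"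
    proof -
      obtain p q where pq: "nb E k = {p, q}" "p \<noteq> q" "E p q" "\<And>u. E p u \<Longrightarrow> E q u \<Longrightarrow> u = k"
        using leaf[OF tk(1)] by blast
      have "t \<in> {p, q}" using S(4)[OF tk(2)] pq(1) nb_iff[of t E k] by simp
      then consider "t = p" | "t = q" by blast
      then show ?thesis
      proof cases
        case 1 then show ?thesis using that[of q] pq by blast
      next
        case 2 then show ?thesis using that[of p] pq S(4)[OF pq(3)] by (metis insert_commute)
      qed
    qed
    have "E k p" using p(1) nb_iff[of p E k] by simp
    then have "p \<in> nb ?D t" using inW[OF _ tk(1)] p(3) t(1) by (auto simp: nb_def del_def)
    with \<open>card (nb ?D t) = 2\<close> obtain q where q: "nb ?D t = {p, q}" "p \<noteq> q"
      by (auto simp: card_2_iff doubleton_eq_iff)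
    have "E t q" "q \<notin> L" using q(1) nb_iff[of q ?D t] by (simp_all add: del_def)
    \<comment> \<open>Otherwise \<open>q\<close> would be a common neighbour of \<open>t\<close> and
      \<open>p\<close> besides \<open>k\<close>.\<close>
    then have "\<not> E p q" using p(4)[of q] tk(1) by blast
    moreover obtain r s where "minimal_counterexample V E k r s" "X = {k, r, s}" using lead[of k] tk(1) LX by blast
    moreover have "nb E t = {k, p, q}" using nbt q(1) by simp
    ultimately show False
      using minimal_no_ladder_step[of V E k r s t p q] t(3) q(2) p(1,2) by simp
  qed
qed

section \<open>Back from monomials to orientations\<close>

lemma monomial_not_in_cubes:
  assumes "simple_graph V E" "K4_minor_free V E" "x \<in> V" "y \<in> V" "z \<in> V" "feasible_triple V E x y z"
  shows "Var x * Var y * Var z * graph_poly E \<notin> cubes"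
proof
  assume "Var x * Var y * Var z * graph_poly E \<in> cubes"
  with assms have "counterexample V E x y z" by (simp add: counterexample_def)
  then show False
  proof (induction "card V" arbitrary: V E x y z rule: less_induct)
    case less
    then have "minimal_counterexample V E x y z" unfolding minimal_counterexample_def by blast
    with no_minimal_counterexample show ?case by (rule notE)
  qed
qed

theorem mainTheorem3:
  fixes V :: "'a set" and E :: "'a \<Rightarrow> 'a \<Rightarrow> bool" and x y z :: 'a
  assumes "simple_graph V E"
    and "K4_minor_free V E"
    and "x \<in> V" "y \<in> V" "z \<in> V"
    and "x \<noteq> y" "x \<noteq> z" "y \<noteq> z"
    and "feasible V E {x, y, z}"
  shows "AT_extendable V E [2, 2, 2] [x, y, z]"
proof -
  have "Var x * Var y * Var z * graph_poly E \<notin> cubes"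
    by (rule monomial_not_in_cubes[OF assms(1-5) feasible_triple_of_feasible[OF assms(1,6-9)]])
  then obtain m where m: "m \<in> Poly_Mapping.keys (Var x * Var y * Var z * graph_poly E)"
    "\<And>v. Poly_Mapping.lookup m v < 3"
    unfolding cubes_def by (auto simp: not_le)
  let ?xyz = "Poly_Mapping.single x 1 + Poly_Mapping.single y 1 + Poly_Mapping.single z (1::nat)"
  have "Var x * Var y * Var z = Poly_Mapping.single ?xyz 1"
    by (simp add: Var_def mult_single)
  with m(1) obtain s where s: "s \<in> Poly_Mapping.keys (graph_poly E)" "m = ?xyz + s"
    using keys_monomial_mult by metis
  obtain A where A: "orientation V E A" "AT_orientation V A" "\<And>v. outdeg A v = Poly_Mapping.lookup s v"
    using AT_orientation_of_monomial[OF assms(1) s(1)] by blast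
  \<comment> \<open>All exponents of \<open>m\<close> are at most 2, and \<open>s\<close> has one
    less at each of the three distinct vertices: this is the bound 1 there and 2 elsewhere.\<close>
  have "int (outdeg A v) \<le> int (case map_of (zip [x, y, z] [2, 2, 2]) v of Some a \<Rightarrow> a | None \<Rightarrow> 3) - 1" for v
    using m(2)[of v] assms(6-8) unfolding A(3) s(2) by (auto simp: lookup_add lookup_single when_def)
  with A(1,2) show ?thesis unfolding AT_extendable_def f_AT_def by blast
qed

end
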